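(* Let $\Phi$ be a (possibly reducible) finite crystallographic root system with irreducible components $\Phi_1,\dots,\Phi_k$. If $F$ is a standard face of the root polytope $\mathcal P_\Phi$, then $\left(x,\sum_{i=1}^k o_i(F)\right)\le 1$ for all $x\in\mathcal P_\Phi$, and $$F=\left\{x\in\mathcal P_\Phi:\left(x,\sum_{i=1}^k o_i(F)\right)=1\right\}.$$
   Context: $\Phi$ is a finite reduced crystallographic root system in $\mathbb E=\mathrm{Span}_{\mathbb R}\Phi$ with (Weyl-group-invariant) positive definite form $(\cdot,\cdot)$, used to identify $\mathbb E$ with its dual; $\Pi$ is a set of simple roots, $\{\check\omega_\alpha:\alpha\in\Pi\}$ is the basis of $\mathbb E$ dual to $\Pi$ (fundamental co-weights), $\mathcal C=\{x\in\mathbb E:(x,\alpha)\ge0\ \forall\alpha\in\Pi\}$ is the fundamental chamber. The root polytope of a root system is the convex hull of its roots. A face of $\mathcal P_\Phi$ is standard if either its relative interior meets $\mathcal C$, or it is empty. Let $\mathbb E_i=\mathrm{Span}(\Phi_i)$, $\Pi_i=\Pi\cap\Phi_i$, $\mathcal P_i=\mathcal P_\Phi\cap\mathbb E_i$ the root polytope of $\Phi_i$, $\theta_i=\sum_{\alpha\in\Pi_i}m_\alpha\alpha$ the highest root of $\Phi_i$, and $o_\alpha=\check\omega_\alpha/m_\alpha$ for $\alpha\in\Pi_i$. A subset $I\subseteq\Pi_i$ is $\widehat\Pi_i$-extremal if removing the vertices in $I$ from the extended Dynkin diagram of $\Phi_i$ (vertices: $\Pi_i$ and the affine vertex) leaves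 a connected graph. For a standard face $F$ let $F_i=F\cap\mathbb E_i$. For every nonempty $F_i$, it is known that there is a unique $\widehat\Pi_i$-extremal subset $\Pi_i(F)$ of $\Pi_i$ such that $F_i=\{x\in\mathcal P_i:(x,o_\alpha)=1\text{ for all }\alpha\in\Pi_i(F)\}$, and one sets $o_i(F)=\frac{1}{|\Pi_i(F)|}\sum_{\alpha\in\Pi_i(F)}o_\alpha$. For $F_i=\emptyset$, one sets $o_i(F)=0$.
   Formalization: A nonempty standard face is required to be a proper face: for F equal to the whole root polytope the sets Π_i(F) are empty and the averages o_i(F) are undefined, so that case is excluded. *)

theory Defs
  imports "HOL-Analysis.Analysis"
begin

text \<open>
  The Euclidean space of a root system \<open>\<Phi>\<close> is \<open>span \<Phi>\<close>, with the inner product of the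
  ambient type; it may be a proper subspace, so the empty root system is included.
\<close>

definition reflection :: "'a::euclidean_space \<Rightarrow> 'a \<Rightarrow> 'a" where
  "reflection \<alpha> x = x - (2 * (x \<bullet> \<alpha>) / (\<alpha> \<bullet> \<alpha>)) *\<^sub>R \<alpha>"

definition root_system :: "'a::euclidean_space set \<Rightarrow> bool" where
  "root_system \<Phi> \<longleftrightarrow>
     finite \<Phi> \<and> 0 \<notin> \<Phi> \<and>
     (\<forall>\<alpha>\<in>\<Phi>. reflection \<alpha> ` \<Phi> = \<Phi>) \<and>
     (\<forall>\<alpha>\<in>\<Phi>. \<forall>\<beta>\<in>\<Phi>. 2 * (\<beta> \<bullet> \<alpha>) / (\<alpha> \<bullet> \<alpha>) \<in> \<int>) \<and>
     (\<forall>\<alpha>\<in>\<Phi>. \<forall>c::real. c *\<^sub>R \<alpha> \<in> \<Phi> \<longrightarrow> c = 1 \<or> c = -1)"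

definition simple_roots :: "'a::euclidean_space set \<Rightarrow> 'a set \<Rightarrow> bool" where
  "simple_roots \<Phi> \<Delta> \<longleftrightarrow>
     \<Delta> \<subseteq> \<Phi> \<and> independent \<Delta> \<and>
     (\<forall>\<beta>\<in>\<Phi>. \<exists>n::'a \<Rightarrow> nat.
        \<beta> = (\<Sum>\<alpha>\<in>\<Delta>. real (n \<alpha>) *\<^sub>R \<alpha>) \<or> \<beta> = - (\<Sum>\<alpha>\<in>\<Delta>. real (n \<alpha>) *\<^sub>R \<alpha>))"

definition irreducible_roots :: "'a::euclidean_space set \<Rightarrow> bool" where
  "irreducible_roots \<Psi> \<longleftrightarrow>
     \<Psi> \<noteq> {} \<and>
     \<not> (\<exists>A B. A \<noteq> {} \<and> B \<noteq> {} \<and> A \<union> B = \<Psi> \<and> A \<inter> B = {} \<and> (\<forall>a\<in>A. \<forall>b\<in>B. a \<bullet> b = 0))"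

definition irreducible_components :: "'a::euclidean_space set \<Rightarrow> 'a set set" where
  "irreducible_components \<Phi> =
     {\<Psi>. \<Psi> \<subseteq> \<Phi> \<and> irreducible_roots \<Psi> \<and> (\<forall>a\<in>\<Psi>. \<forall>b\<in>\<Phi> - \<Psi>. a \<bullet> b = 0)}"

definition root_polytope :: "'a::euclidean_space set \<Rightarrow> 'a set" where
  "root_polytope \<Phi> = convex hull \<Phi>"

definition fundamental_chamber :: "'a::euclidean_space set \<Rightarrow> 'a set \<Rightarrow> 'a set" where
  "fundamental_chamber \<Phi> \<Delta> = {x \<in> span \<Phi>. \<forall>\<alpha>\<in>\<Delta>. 0 \<le> x \<bullet> \<alpha>}"

text \<open>
  Unlike \<open>face_of\<close>, ``face'' here excludes the whole polytope (the empty face is always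
  allowed): for \<open>F\<close> the whole polytope of a nonempty root system the set defining \<open>o\<^sub>i(F)\<close>
  would be empty, and the average over it meaningless.
\<close>

definition standard_face :: "'a::euclidean_space set \<Rightarrow> 'a set \<Rightarrow> 'a set \<Rightarrow> bool" where
  "standard_face \<Phi> \<Delta> F \<longleftrightarrow>
     F face_of root_polytope \<Phi> \<and>
     (F = {} \<or> F \<noteq> root_polytope \<Phi> \<and> rel_interior F \<inter> fundamental_chamber \<Phi> \<Delta> \<noteq> {})"

text \<open>
  In the following definitions \<open>\<Psi>\<close> is an irreducible component of \<open>\<Phi>\<close>, and
  \<open>\<Delta> \<inter> \<Psi>\<close> is its set of simple roots.
\<close>

definition fund_coweight :: "'a::euclidean_space set \<Rightarrow> 'a set \<Rightarrow> 'a \<Rightarrow> 'a" where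
  "fund_coweight \<Phi> \<Delta> \<alpha> =
     (THE w. w \<in> span \<Phi> \<and> (\<forall>\<beta>\<in>\<Delta>. w \<bullet> \<beta> = (if \<beta> = \<alpha> then 1 else 0)))"

definition highest_root :: "'a::euclidean_space set \<Rightarrow> 'a set \<Rightarrow> 'a" where
  "highest_root \<Delta> \<Psi> =
     (THE \<theta>. \<theta> \<in> \<Psi> \<and>
        (\<forall>\<beta>\<in>\<Psi>. \<exists>n::'a \<Rightarrow> nat. \<theta> - \<beta> = (\<Sum>\<alpha>\<in>\<Delta> \<inter> \<Psi>. real (n \<alpha>) *\<^sub>R \<alpha>)))"

definition highest_root_coeff :: "'a::euclidean_space set \<Rightarrow> 'a set \<Rightarrow> 'a \<Rightarrow> real" where
  "highest_root_coeff \<Delta> \<Psi> \<alpha> = representation (\<Delta> \<inter> \<Psi>) (highest_root \<Delta> \<Psi>) \<alpha>"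

definition o_vec :: "'a::euclidean_space set \<Rightarrow> 'a set \<Rightarrow> 'a set \<Rightarrow> 'a \<Rightarrow> 'a" where
  "o_vec \<Phi> \<Delta> \<Psi> \<alpha> = (1 / highest_root_coeff \<Delta> \<Psi> \<alpha>) *\<^sub>R fund_coweight \<Phi> \<Delta> \<alpha>"

text \<open>
  Vertices of the (extended) Dynkin diagram are represented by the roots labelling them, the
  affine vertex by minus the highest root; two distinct vertices are joined iff they are not
  orthogonal. Edge multiplicities and arrows play no role for connectedness.
\<close>

definition diagram_connected :: "'a::euclidean_space set \<Rightarrow> bool" where
  "diagram_connected V \<longleftrightarrow>
     (\<forall>u\<in>V. \<forall>v\<in>V. (u, v) \<in> {(a, b). a \<in> V \<and> b \<in> V \<and> a \<noteq> b \<and> a \<bullet> b \<noteq> 0}\<^sup>*)"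

definition extended_simple_roots :: "'a::euclidean_space set \<Rightarrow> 'a set \<Rightarrow> 'a set" where
  "extended_simple_roots \<Delta> \<Psi> = insert (- highest_root \<Delta> \<Psi>) (\<Delta> \<inter> \<Psi>)"

definition extremal :: "'a::euclidean_space set \<Rightarrow> 'a set \<Rightarrow> 'a set \<Rightarrow> bool" where
  "extremal \<Delta> \<Psi> I \<longleftrightarrow>
     I \<subseteq> \<Delta> \<inter> \<Psi> \<and> diagram_connected (extended_simple_roots \<Delta> \<Psi> - I)"

definition face_simple_roots ::
    "'a::euclidean_space set \<Rightarrow> 'a set \<Rightarrow> 'a set \<Rightarrow> 'a set \<Rightarrow> 'a set" where
  "face_simple_roots \<Phi> \<Delta> \<Psi> F =
     (THE I. extremal \<Delta> \<Psi> I \<and>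
        F \<inter> span \<Psi> = {x \<in> root_polytope \<Phi> \<inter> span \<Psi>. \<forall>\<alpha>\<in>I. x \<bullet> o_vec \<Phi> \<Delta> \<Psi> \<alpha> = 1})"

definition o_face ::
    "'a::euclidean_space set \<Rightarrow> 'a set \<Rightarrow> 'a set \<Rightarrow> 'a set \<Rightarrow> 'a" where
  "o_face \<Phi> \<Delta> \<Psi> F =
     (if F \<inter> span \<Psi> = {} then 0
      else (1 / real (card (face_simple_roots \<Phi> \<Delta> \<Psi> F))) *\<^sub>R
             (\<Sum>\<alpha>\<in>face_simple_roots \<Phi> \<Delta> \<Psi> F. o_vec \<Phi> \<Delta> \<Psi> \<alpha>))"

end

theory Submission
  imports Defs
begin

text \<open>
  A nonempty standard face \<open>F\<close> has a dominant normal \<open>f\<close>: the face is cut out by \<open>(x, f) = 1\<close>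
  with \<open>(\<alpha>, f) \<ge> 0\<close> for all simple \<open>\<alpha>\<close>. If \<open>F\<close> meets a component \<open>\<Psi>\<close> with highest root \<open>\<theta>\<close>,
  then \<open>(\<theta>, f) = 1\<close>, and the roots of \<open>\<Psi>\<close> in \<open>F\<close> are those having the same coefficient as
  \<open>\<theta>\<close> at every simple root of \<open>I = {\<alpha>. (\<alpha>, f) > 0}\<close>. Enlarging \<open>I\<close> by the simple roots not
  connected to the affine vertex in the extended diagram minus \<open>I\<close> does not change this set of
  roots and gives the extremal subset; an extremal subset is recovered from its set of roots as
  the set of simple roots whose coefficient is constantly maximal. On roots of \<open>\<Psi>\<close> each
  \<open>o\<^sub>\<alpha>\<close> is at most \<open>1\<close>, so the average \<open>o\<^sub>i(F)\<close> equals \<open>1\<close> exactly on the roots in \<open>F\<close>, and it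
  vanishes on the other components. Hence the sum of the \<open>o\<^sub>i(F)\<close> is a normal of \<open>F\<close>.
\<close>

section \<open>Roots and simple roots\<close>

lemma linear_reflection: "linear (reflection \<alpha>)"
  unfolding reflection_def
  by (rule linearI)
    (simp_all add: inner_add_left scaleR_add_left scaleR_diff_right algebra_simps add_divide_distrib)

lemma reflection_reflection [simp]: "reflection \<alpha> (reflection \<alpha> x) = x"
  by (cases "\<alpha> = 0") (simp_all add: reflection_def inner_diff_left algebra_simps)

lemma reflection_self: "\<alpha> \<noteq> 0 \<Longrightarrow> reflection \<alpha> \<alpha> = - \<alpha>"
  by (simp add: reflection_def scaleR_2)

lemma reflection_orthogonal: "x \<bullet> \<alpha> = 0 \<Longrightarrow> reflection \<alpha> x = x"
  by (simp add: reflection_def)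

lemma reflection_eq_self_iff: "\<alpha> \<noteq> 0 \<Longrightarrow> reflection \<alpha> x = x \<longleftrightarrow> x \<bullet> \<alpha> = 0"
  by (auto simp: reflection_def)

lemma inner_reflection: "reflection \<alpha> x \<bullet> y = x \<bullet> reflection \<alpha> y"
  by (simp add: reflection_def inner_diff_left inner_diff_right inner_commute)

lemma norm_reflection [simp]: "norm (reflection \<alpha> x) = norm x"
  by (simp add: norm_eq_sqrt_inner inner_reflection)

lemma finite_ex_max:
  fixes f :: "'b \<Rightarrow> real"
  assumes "finite A" "A \<noteq> {}"
  shows "\<exists>x\<in>A. \<forall>y\<in>A. f y \<le> f x"
proof -
  have "Max (f ` A) \<in> f ` A"
    using assms by (intro Max_in) auto
  then obtain x where "x \<in> A" "f x = Max (f ` A)"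
    by auto
  then show ?thesis
    using assms(1) by (metis Max_ge finite_imageI imageI)
qed

lemma supporting_hull_le:
  fixes g :: "'a::real_inner"
  assumes "\<And>s. s \<in> S \<Longrightarrow> s \<bullet> g \<le> 1"
  shows "convex hull S \<subseteq> {x. x \<bullet> g \<le> 1}"
  using assms convex_halfspace_le[of g 1] by (intro hull_minimal) (auto simp: inner_commute)

lemma supporting_slice_eq:
  fixes g :: "'a::real_inner"
  assumes "finite S" and le: "\<And>s. s \<in> S \<Longrightarrow> s \<bullet> g \<le> 1"
  shows "{x \<in> convex hull S. x \<bullet> g = 1} = convex hull {s\<in>S. s \<bullet> g = 1}"
proof
  have "convex hull {s\<in>S. s \<bullet> g = 1} \<subseteq> {x. x \<bullet> g = 1}"
    using convex_hyperplane[of g 1] by (intro hull_minimal) (auto simp: inner_commute)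
  moreover have "convex hull {s\<in>S. s \<bullet> g = 1} \<subseteq> convex hull S"
    by (intro hull_mono) blast
  ultimately show "convex hull {s\<in>S. s \<bullet> g = 1} \<subseteq> {x \<in> convex hull S. x \<bullet> g = 1}"
    by blast
  show "{x \<in> convex hull S. x \<bullet> g = 1} \<subseteq> convex hull {s\<in>S. s \<bullet> g = 1}"
  proof
    fix x assume x: "x \<in> {x \<in> convex hull S. x \<bullet> g = 1}"
    then obtain u where u: "\<forall>s\<in>S. 0 \<le> u s" "sum u S = 1" "(\<Sum>s\<in>S. u s *\<^sub>R s) = x"
      unfolding convex_hull_finite[OF assms(1)] by auto
    have "(\<Sum>s\<in>S. u s * (1 - s \<bullet> g)) = sum u S - (\<Sum>s\<in>S. u s *\<^sub>R s) \<bullet> g"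
      by (simp add: inner_sum_left sum_subtractf right_diff_distrib)
    also have "\<dots> = 0"
      using x u by simp
    finally have "\<forall>s\<in>S. u s * (1 - s \<bullet> g) = 0"
      using sum_nonneg_eq_0_iff[OF assms(1), of "\<lambda>s. u s * (1 - s \<bullet> g)"] u(1) le by simp
    then have 0: "u s = 0" if "s \<in> S - {s\<in>S. s \<bullet> g = 1}" for s
      using that by auto
    have "sum u {s\<in>S. s \<bullet> g = 1} = sum u S"
      using assms(1) 0 by (intro sum.mono_neutral_left) blast+
    moreover have "(\<Sum>s\<in>{s\<in>S. s \<bullet> g = 1}. u s *\<^sub>R s) = (\<Sum>s\<in>S. u s *\<^sub>R s)"
      using assms(1) 0 by (intro sum.mono_neutral_left) auto
    ultimately show "x \<in> convex hull {s\<in>S. s \<bullet> g = 1}"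
      using assms(1) u by (subst convex_hull_finite) auto
  qed
qed

lemma average_le_1:
  fixes h :: "'b \<Rightarrow> real"
  assumes "finite J" "J \<noteq> {}" and le: "\<And>a. a \<in> J \<Longrightarrow> h a \<le> 1"
  shows "sum h J / real (card J) \<le> 1 \<and> (sum h J / real (card J) = 1 \<longleftrightarrow> (\<forall>a\<in>J. h a = 1))"
proof -
  have pos: "real (card J) > 0"
    using assms by (simp add: card_gt_0_iff)
  have diff: "(\<Sum>a\<in>J. 1 - h a) = real (card J) - sum h J"
    by (simp add: sum_subtractf)
  have "0 \<le> (\<Sum>a\<in>J. 1 - h a)"
    using le by (intro sum_nonneg) simp
  moreover have "(\<Sum>a\<in>J. 1 - h a) = 0 \<longleftrightarrow> (\<forall>a\<in>J. h a = 1)"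
    using sum_nonneg_eq_0_iff[OF assms(1), of "\<lambda>a. 1 - h a"] le by auto
  ultimately show ?thesis
    unfolding diff using pos by (auto simp: divide_le_eq)
qed

locale based_root_system =
  fixes \<Phi> \<Delta> :: "'a::euclidean_space set"
  assumes roots: "root_system \<Phi>"
    and base: "simple_roots \<Phi> \<Delta>"
begin

lemma finite_roots: "finite \<Phi>"
  and zero_notin_roots: "0 \<notin> \<Phi>"
  and reflection_image: "\<alpha> \<in> \<Phi> \<Longrightarrow> reflection \<alpha> ` \<Phi> = \<Phi>"
  and cartan_integer: "\<alpha> \<in> \<Phi> \<Longrightarrow> \<beta> \<in> \<Phi> \<Longrightarrow> 2 * (\<beta> \<bullet> \<alpha>) / (\<alpha> \<bullet> \<alpha>) \<in> \<int>"
  and reduced: "\<alpha> \<in> \<Phi> \<Longrightarrow> c *\<^sub>R \<alpha> \<in> \<Phi> \<Longrightarrow> c = 1 \<or> c = -1"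
  using roots unfolding root_system_def by auto

lemma reflection_in_roots: "\<alpha> \<in> \<Phi> \<Longrightarrow> \<beta> \<in> \<Phi> \<Longrightarrow> reflection \<alpha> \<beta> \<in> \<Phi>"
  using reflection_image by blast

lemma uminus_in_roots: "\<alpha> \<in> \<Phi> \<Longrightarrow> - \<alpha> \<in> \<Phi>"
  by (metis reflection_in_roots reflection_self zero_notin_roots)

lemma base_subset: "\<Delta> \<subseteq> \<Phi>"
  and independent_base: "independent \<Delta>"
  using base unfolding simple_roots_def by auto

lemma finite_base: "finite \<Delta>"
  using base_subset finite_roots finite_subset by blast

lemma base_nonzero: "\<alpha> \<in> \<Delta> \<Longrightarrow> \<alpha> \<noteq> 0"
  using base_subset zero_notin_roots by auto

lemma base_inner_pos: "\<alpha> \<in> \<Delta> \<Longrightarrow> \<alpha> \<bullet> \<alpha> > 0"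
  using base_nonzero by auto

lemma span_roots: "span \<Phi> = span \<Delta>"
proof
  have "\<Phi> \<subseteq> span \<Delta>"
  proof
    fix \<beta> assume "\<beta> \<in> \<Phi>"
    then obtain n where "\<beta> = (\<Sum>\<alpha>\<in>\<Delta>. real (n \<alpha>) *\<^sub>R \<alpha>) \<or> \<beta> = - (\<Sum>\<alpha>\<in>\<Delta>. real (n \<alpha>) *\<^sub>R \<alpha>)"
      using base unfolding simple_roots_def by blast
    then show "\<beta> \<in> span \<Delta>"
      by (auto intro: span_neg span_sum span_scale span_base)
  qed
  then show "span \<Phi> \<subseteq> span \<Delta>"
    by (simp add: span_minimal)
  show "span \<Delta> \<subseteq> span \<Phi>"
    by (simp add: base_subset span_mono)
qed

lemma ex1_dual_vector:
  "\<exists>!w. w \<in> span \<Phi> \<and> (\<forall>\<beta>\<in>\<Delta>. w \<bullet> \<beta> = (if \<beta> = \<alpha> then 1 else 0))"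
proof (rule ex_ex1I)
  obtain g :: "'a \<Rightarrow> real" where g: "linear g" "\<And>\<beta>. \<beta> \<in> \<Delta> \<Longrightarrow> g \<beta> = (if \<beta> = \<alpha> then 1 else 0)"
    using linear_independent_extend[OF independent_base, of "\<lambda>\<beta>. if \<beta> = \<alpha> then 1 else 0"] by metis
  define v where "v = (\<Sum>b\<in>Basis. g b *\<^sub>R b)"
  have v: "g x = v \<bullet> x" for x
  proof -
    have "g x = g (\<Sum>b\<in>Basis. (x \<bullet> b) *\<^sub>R b)"
      by (simp add: euclidean_representation)
    also have "\<dots> = v \<bullet> x"
      using g(1) unfolding v_def
      by (simp add: linear_sum linear_scale inner_sum_left inner_commute[of x] mult.commute)
    finally show ?thesis .
  qed
  obtain y z where yz: "y \<in> span \<Delta>" "\<And>w. w \<in> span \<Delta> \<Longrightarrow> orthogonal z w" "v = y + z"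
    using orthogonal_subspace_decomp_exists[of \<Delta> v] by blast
  have "y \<bullet> \<beta> = g \<beta>" if "\<beta> \<in> \<Delta>" for \<beta>
    using yz(2)[of \<beta>] v[of \<beta>] yz(3) span_base[OF that] by (simp add: orthogonal_def inner_add_left)
  then show "\<exists>w. w \<in> span \<Phi> \<and> (\<forall>\<beta>\<in>\<Delta>. w \<bullet> \<beta> = (if \<beta> = \<alpha> then 1 else 0))"
    using yz(1) g(2) span_roots by (intro exI[of _ y]) auto
next
  fix w w'
  assume w: "w \<in> span \<Phi> \<and> (\<forall>\<beta>\<in>\<Delta>. w \<bullet> \<beta> = (if \<beta> = \<alpha> then 1 else 0))"
    and w': "w' \<in> span \<Phi> \<and> (\<forall>\<beta>\<in>\<Delta>. w' \<bullet> \<beta> = (if \<beta> = \<alpha> then 1 else 0))"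
  have "w - w' \<in> span \<Delta>"
    using w w' span_diff span_roots by blast
  moreover have "orthogonal (w - w') \<beta>" if "\<beta> \<in> \<Delta>" for \<beta>
    using w w' that by (simp add: orthogonal_def inner_diff_left)
  ultimately have "orthogonal (w - w') (w - w')"
    using orthogonal_to_span by blast
  then show "w = w'"
    by (simp add: orthogonal_self)
qed

definition coef :: "'a \<Rightarrow> 'a \<Rightarrow> real" where
  "coef \<alpha> x = x \<bullet> fund_coweight \<Phi> \<Delta> \<alpha>"

lemma coef_base: "\<beta> \<in> \<Delta> \<Longrightarrow> coef \<alpha> \<beta> = (if \<beta> = \<alpha> then 1 else 0)"
  using theI'[OF ex1_dual_vector[of \<alpha>]] unfolding coef_def fund_coweight_def
  by (simp add: inner_commute)

lemma coef_simps [simp]: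
  "coef \<alpha> (x + y) = coef \<alpha> x + coef \<alpha> y"
  "coef \<alpha> (x - y) = coef \<alpha> x - coef \<alpha> y"
  "coef \<alpha> (- x) = - coef \<alpha> x"
  "coef \<alpha> (c *\<^sub>R x) = c * coef \<alpha> x"
  "coef \<alpha> 0 = 0"
  by (simp_all add: coef_def inner_add_left inner_diff_left)

lemma coef_sum: "coef \<alpha> (sum f A) = (\<Sum>a\<in>A. coef \<alpha> (f a))"
  by (simp add: coef_def inner_sum_left)

lemma coef_sum_base:
  assumes "\<alpha> \<in> \<Delta>" "S \<subseteq> \<Delta>"
  shows "coef \<alpha> (\<Sum>\<gamma>\<in>S. c \<gamma> *\<^sub>R \<gamma>) = (if \<alpha> \<in> S then c \<alpha> else 0)"
proof -
  have "coef \<alpha> (\<Sum>\<gamma>\<in>S. c \<gamma> *\<^sub>R \<gamma>) = (\<Sum>\<gamma>\<in>S. if \<gamma> = \<alpha> then c \<gamma> else 0)"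
    unfolding coef_sum using assms by (intro sum.cong) (auto simp: coef_base)
  then show ?thesis
    using finite_subset[OF assms(2) finite_base] by simp
qed

lemma coef_expansion:
  assumes "x \<in> span \<Phi>"
  shows "x = (\<Sum>\<alpha>\<in>\<Delta>. coef \<alpha> x *\<^sub>R \<alpha>)"
proof -
  obtain u where u: "x = (\<Sum>\<alpha>\<in>\<Delta>. u \<alpha> *\<^sub>R \<alpha>)"
    using assms span_finite[OF finite_base] span_roots by auto
  then have "coef \<alpha> x = u \<alpha>" if "\<alpha> \<in> \<Delta>" for \<alpha>
    using coef_sum_base[OF that, of \<Delta> u] that by simp
  then show ?thesis
    using u by (metis (no_types, lifting) sum.cong)
qed

lemma inner_expansion:
  assumes "x \<in> span \<Phi>"
  shows "x \<bullet> y = (\<Sum>\<alpha>\<in>\<Delta>. coef \<alpha> x * (\<alpha> \<bullet> y))"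
  by (subst coef_expansion[OF assms]) (simp add: inner_sum_left)

lemma coef_roots:
  assumes "\<beta> \<in> \<Phi>"
  shows "(\<forall>\<alpha>\<in>\<Delta>. coef \<alpha> \<beta> \<in> \<int>) \<and> ((\<forall>\<alpha>\<in>\<Delta>. 0 \<le> coef \<alpha> \<beta>) \<or> (\<forall>\<alpha>\<in>\<Delta>. coef \<alpha> \<beta> \<le> 0))"
proof -
  obtain n where "\<beta> = (\<Sum>\<alpha>\<in>\<Delta>. real (n \<alpha>) *\<^sub>R \<alpha>) \<or> \<beta> = - (\<Sum>\<alpha>\<in>\<Delta>. real (n \<alpha>) *\<^sub>R \<alpha>)"
    using base assms unfolding simple_roots_def by blast
  then show ?thesis
    using coef_sum_base[of _ \<Delta> "\<lambda>\<alpha>. real (n \<alpha>)"] by auto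
qed

lemma coef_nonzero:
  assumes "\<beta> \<in> \<Phi>"
  obtains \<alpha> where "\<alpha> \<in> \<Delta>" "coef \<alpha> \<beta> \<noteq> 0"
  using coef_expansion[OF span_base[OF assms]] assms zero_notin_roots
  by (metis (no_types, lifting) scaleR_zero_left sum.neutral)

lemma coef_nonneg:
  assumes "\<beta> \<in> \<Phi>" "\<alpha> \<in> \<Delta>" "coef \<alpha> \<beta> > 0" "\<gamma> \<in> \<Delta>"
  shows "coef \<gamma> \<beta> \<ge> 0"
  using coef_roots[OF assms(1)] assms(2-) by force

lemma coef_reflection:
  assumes "\<gamma> \<in> \<Delta>"
  shows "coef \<alpha> (reflection \<gamma> \<beta>) = coef \<alpha> \<beta> - (if \<alpha> = \<gamma> then 2 * (\<beta> \<bullet> \<gamma>) / (\<gamma> \<bullet> \<gamma>) else 0)"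
  using assms by (simp add: reflection_def coef_base)

lemma base_inner_nonpos:
  assumes "\<alpha> \<in> \<Delta>" "\<beta> \<in> \<Delta>" "\<alpha> \<noteq> \<beta>"
  shows "\<alpha> \<bullet> \<beta> \<le> 0"
proof (rule ccontr)
  assume "\<not> \<alpha> \<bullet> \<beta> \<le> 0"
  then have "coef \<beta> (reflection \<beta> \<alpha>) < 0" "coef \<alpha> (reflection \<beta> \<alpha>) > 0"
    using assms base_inner_pos[OF assms(2)] by (simp_all add: coef_reflection coef_base)
  moreover have "reflection \<beta> \<alpha> \<in> \<Phi>"
    using assms base_subset reflection_in_roots by blast
  ultimately show False
    using coef_nonneg assms by (metis not_less)
qed

definition height :: "'a \<Rightarrow> real" where
  "height x = (\<Sum>\<alpha>\<in>\<Delta>. coef \<alpha> x)"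

lemma height_reflection:
  assumes "\<gamma> \<in> \<Delta>"
  shows "height (reflection \<gamma> \<beta>) = height \<beta> - 2 * (\<beta> \<bullet> \<gamma>) / (\<gamma> \<bullet> \<gamma>)"
  using finite_base assms
  by (simp add: height_def coef_reflection sum_subtractf)

lemma ex_base_inner_pos:
  assumes "\<beta> \<in> span \<Phi>" "\<beta> \<noteq> 0"
  obtains \<alpha> where "\<alpha> \<in> \<Delta>" "coef \<alpha> \<beta> * (\<alpha> \<bullet> \<beta>) > 0"
proof -
  have "0 < (\<Sum>\<alpha>\<in>\<Delta>. coef \<alpha> \<beta> * (\<alpha> \<bullet> \<beta>))"
    using inner_expansion[OF assms(1), of \<beta>] assms(2) by (metis inner_gt_zero_iff)
  then show thesis
    using that by (meson not_less sum_nonpos)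
qed

text \<open>
  A mixed positive root of least height would be sent by a suitable simple reflection to a
  positive root supported on one side and orthogonal to the reflecting simple root.
\<close>

lemma pure_support:
  assumes ST: "S \<union> T = \<Delta>" "S \<inter> T = {}" "\<And>s t. s \<in> S \<Longrightarrow> t \<in> T \<Longrightarrow> s \<bullet> t = 0"
    and \<beta>: "\<beta> \<in> \<Phi>"
  shows "(\<forall>\<alpha>\<in>S. coef \<alpha> \<beta> = 0) \<or> (\<forall>\<alpha>\<in>T. coef \<alpha> \<beta> = 0)"
proof (rule ccontr)
  assume mixed: "\<not> ?thesis"
  define M where "M = {\<beta>\<in>\<Phi>. (\<exists>\<alpha>\<in>S. coef \<alpha> \<beta> > 0) \<and> (\<exists>\<alpha>\<in>T. coef \<alpha> \<beta> > 0)}"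
  have "finite M"
    using finite_roots M_def by simp
  moreover have "M \<noteq> {}"
  proof (cases "\<forall>\<alpha>\<in>\<Delta>. 0 \<le> coef \<alpha> \<beta>")
    case True
    then have "coef \<alpha> \<beta> > 0 \<longleftrightarrow> coef \<alpha> \<beta> \<noteq> 0" if "\<alpha> \<in> \<Delta>" for \<alpha>
      using that by (metis less_eq_real_def less_irrefl)
    then have "\<beta> \<in> M"
      using mixed ST(1) \<beta> unfolding M_def by blast
    then show ?thesis by blast
  next
    case False
    then have "\<forall>\<alpha>\<in>\<Delta>. coef \<alpha> \<beta> \<le> 0"
      using coef_roots[OF \<beta>] by blast
    then have "coef \<alpha> (- \<beta>) > 0 \<longleftrightarrow> coef \<alpha> \<beta> \<noteq> 0" if "\<alpha> \<in> \<Delta>" for \<alpha>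
      using that by force
    then have "- \<beta> \<in> M"
      using mixed ST(1) uminus_in_roots[OF \<beta>] unfolding M_def by blast
    then show ?thesis by blast
  qed
  ultimately have "\<exists>\<mu>\<in>M. \<forall>\<beta>\<in>M. - height \<beta> \<le> - height \<mu>"
    by (rule finite_ex_max)
  then obtain \<mu> where \<mu>: "\<mu> \<in> M" and least: "\<And>\<beta>. \<beta> \<in> M \<Longrightarrow> height \<mu> \<le> height \<beta>"
    by auto
  have \<mu>\<Phi>: "\<mu> \<in> \<Phi>"
    using \<mu> M_def by simp
  have contra: False if UV: "U \<union> V = \<Delta>" "U \<inter> V = {}" "\<And>s t. s \<in> U \<Longrightarrow> t \<in> V \<Longrightarrow> s \<bullet> t = 0"
    and \<alpha>: "\<alpha> \<in> U" "coef \<alpha> \<mu> * (\<alpha> \<bullet> \<mu>) > 0" and v: "\<exists>v\<in>V. coef v \<mu> > 0"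
    and M: "M = {\<beta>\<in>\<Phi>. (\<exists>\<alpha>\<in>U. coef \<alpha> \<beta> > 0) \<and> (\<exists>\<alpha>\<in>V. coef \<alpha> \<beta> > 0)}" for U V \<alpha>
  proof -
    obtain v where v: "v \<in> V" "coef v \<mu> > 0"
      using v by blast
    have \<alpha>\<Delta>: "\<alpha> \<in> \<Delta>" and v\<Delta>: "v \<in> \<Delta>" and "v \<noteq> \<alpha>"
      using UV \<alpha> v by auto
    have "coef \<alpha> \<mu> \<ge> 0"
      using coef_nonneg[OF \<mu>\<Phi> v\<Delta> v(2) \<alpha>\<Delta>] .
    then have pos: "\<mu> \<bullet> \<alpha> > 0"
      using \<alpha>(2) by (simp add: zero_less_mult_iff inner_commute)
    define \<nu> where "\<nu> = reflection \<alpha> \<mu>"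
    have \<nu>: "\<nu> \<in> \<Phi>"
      using \<nu>_def \<alpha>\<Delta> base_subset \<mu>\<Phi> reflection_in_roots by blast
    have "height \<nu> < height \<mu>"
      using pos base_inner_pos[OF \<alpha>\<Delta>] by (simp add: \<nu>_def height_reflection[OF \<alpha>\<Delta>])
    then have "\<nu> \<notin> M"
      using least by (meson not_less)
    moreover have v\<nu>: "coef v \<nu> > 0"
      using v \<open>v \<noteq> \<alpha>\<close> by (simp add: \<nu>_def coef_reflection[OF \<alpha>\<Delta>])
    ultimately have "\<not> coef u \<nu> > 0" if "u \<in> U" for u
      using that \<nu> v(1) unfolding M by blast
    then have "coef u \<nu> = 0" if "u \<in> U" for u
      using coef_nonneg[OF \<nu> v\<Delta> v\<nu>, of u] that UV(1) by (metis UnI1 less_eq_real_def)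
    then have "\<nu> \<bullet> \<alpha> = 0"
      unfolding inner_expansion[OF span_base[OF \<nu>]] using UV \<alpha>(1)
      by (intro sum.neutral) (force simp: inner_commute)
    then have "\<mu> = \<nu>"
      using reflection_orthogonal \<nu>_def by (metis reflection_reflection)
    then show False
      using \<open>height \<nu> < height \<mu>\<close> by simp
  qed
  obtain \<alpha> where \<alpha>: "\<alpha> \<in> \<Delta>" "coef \<alpha> \<mu> * (\<alpha> \<bullet> \<mu>) > 0"
    using ex_base_inner_pos[OF span_base[OF \<mu>\<Phi>]] zero_notin_roots \<mu>\<Phi> by blast
  show False
  proof (cases "\<alpha> \<in> S")
    case True
    moreover have "\<exists>v\<in>T. coef v \<mu> > 0"
      using \<mu> unfolding M_def by blast
    ultimately show False
      using contra[of S T \<alpha>] ST \<alpha>(2) M_def by metis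
  next
    case False
    then have "\<alpha> \<in> T"
      using ST(1) \<alpha>(1) by blast
    moreover have "T \<union> S = \<Delta>" "T \<inter> S = {}" "\<And>t s. t \<in> T \<Longrightarrow> s \<in> S \<Longrightarrow> t \<bullet> s = 0"
      using ST by (metis Un_commute Int_commute inner_commute)+
    moreover have "M = {\<beta>\<in>\<Phi>. (\<exists>\<alpha>\<in>T. coef \<alpha> \<beta> > 0) \<and> (\<exists>\<alpha>\<in>S. coef \<alpha> \<beta> > 0)}"
      "\<exists>v\<in>S. coef v \<mu> > 0"
      using \<mu> unfolding M_def by blast+
    ultimately show False
      using contra[of T S \<alpha>] \<alpha>(2) by metis
  qed
qed

lemma diff_in_roots:
  assumes "\<alpha> \<in> \<Phi>" "\<beta> \<in> \<Phi>" "\<alpha> \<noteq> \<beta>" "\<alpha> \<bullet> \<beta> > 0"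
  shows "\<alpha> - \<beta> \<in> \<Phi>"
proof -
  have nz: "\<alpha> \<bullet> \<alpha> > 0" "\<beta> \<bullet> \<beta> > 0"
    using assms zero_notin_roots by auto
  obtain p q :: int where p: "2 * (\<alpha> \<bullet> \<beta>) / (\<beta> \<bullet> \<beta>) = of_int p" and q: "2 * (\<alpha> \<bullet> \<beta>) / (\<alpha> \<bullet> \<alpha>) = of_int q"
    using cartan_integer[of \<beta> \<alpha>] cartan_integer[of \<alpha> \<beta>] assms(1,2) by (metis Ints_cases inner_commute)
  have "of_int p > (0::real)" "of_int q > (0::real)"
    unfolding p[symmetric] q[symmetric] using nz assms(4) by simp_all
  then have pq: "p \<ge> 1" "q \<ge> 1"
    by simp_all
  have "\<not> (\<alpha> \<bullet> \<beta>)\<^sup>2 = (\<alpha> \<bullet> \<alpha>) * (\<beta> \<bullet> \<beta>)"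
  proof
    assume "(\<alpha> \<bullet> \<beta>)\<^sup>2 = (\<alpha> \<bullet> \<alpha>) * (\<beta> \<bullet> \<beta>)"
    then have "(\<alpha> \<bullet> \<beta>)\<^sup>2 = (norm \<alpha> * norm \<beta>)\<^sup>2"
      by (simp add: power2_norm_eq_inner power_mult_distrib)
    then have "\<alpha> \<bullet> \<beta> = norm \<alpha> * norm \<beta>"
      using assms(4) by (simp add: power2_eq_iff_nonneg)
    then have "norm \<alpha> *\<^sub>R \<beta> = norm \<beta> *\<^sub>R \<alpha>"
      by (simp add: norm_cauchy_schwarz_eq)
    then have \<beta>: "\<beta> = (norm \<beta> / norm \<alpha>) *\<^sub>R \<alpha>"
      using nz(1) by (metis (no_types, lifting) divide_inverse_commute inner_gt_zero_iff norm_eq_zero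
        right_inverse scaleR_one scaleR_scaleR mult.commute)
    then have "norm \<beta> / norm \<alpha> = 1 \<or> norm \<beta> / norm \<alpha> = -1"
      using reduced assms(1,2) by metis
    moreover have "norm \<beta> / norm \<alpha> \<ge> 0"
      by simp
    ultimately have "norm \<beta> / norm \<alpha> = 1"
      by linarith
    then show False
      using \<beta> assms(3) by (metis scaleR_one)
  qed
  moreover have "(\<alpha> \<bullet> \<beta>)\<^sup>2 \<le> (\<alpha> \<bullet> \<alpha>) * (\<beta> \<bullet> \<beta>)"
    by (rule Cauchy_Schwarz_ineq)
  ultimately have "(\<alpha> \<bullet> \<beta>)\<^sup>2 < (\<alpha> \<bullet> \<alpha>) * (\<beta> \<bullet> \<beta>)"
    by simp
  then have "of_int p * of_int q < (4::real)"
    unfolding p[symmetric] q[symmetric] using nz by (simp add: field_simps power2_eq_square)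
  then have "p * q < 4"
    by (metis of_int_less_numeral_iff of_int_mult)
  have "p = 1 \<or> q = 1"
  proof (rule ccontr)
    assume "\<not> (p = 1 \<or> q = 1)"
    then have "2 * 2 \<le> p * q"
      using pq by (intro mult_mono) auto
    then show False
      using \<open>p * q < 4\<close> by simp
  qed
  then show ?thesis
  proof
    assume "p = 1"
    then have "reflection \<beta> \<alpha> = \<alpha> - \<beta>"
      using p unfolding reflection_def by (metis of_int_1 scaleR_one)
    then show ?thesis
      using reflection_in_roots assms by metis
  next
    assume "q = 1"
    then have "reflection \<alpha> \<beta> = - (\<alpha> - \<beta>)"
      using q unfolding reflection_def by (metis inner_commute minus_diff_eq of_int_1 scaleR_one)
    then show ?thesis
      using reflection_in_roots uminus_in_roots assms by (metis minus_minus)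
  qed
qed

end

section \<open>The highest root of an irreducible component\<close>

locale root_component = based_root_system +
  fixes \<Psi> :: "'a set"
  assumes component: "\<Psi> \<in> irreducible_components \<Phi>"
begin

lemma component_subset: "\<Psi> \<subseteq> \<Phi>"
  and component_irreducible: "irreducible_roots \<Psi>"
  and component_orthogonal: "a \<in> \<Psi> \<Longrightarrow> b \<in> \<Phi> \<Longrightarrow> b \<notin> \<Psi> \<Longrightarrow> a \<bullet> b = 0"
  using component unfolding irreducible_components_def by auto

lemma finite_component: "finite \<Psi>"
  using component_subset finite_roots finite_subset by blast

lemma reflection_in_component:
  assumes "\<alpha> \<in> \<Psi>" "\<beta> \<in> \<Psi>"
  shows "reflection \<alpha> \<beta> \<in> \<Psi>"
proof (rule ccontr)
  assume "reflection \<alpha> \<beta> \<notin> \<Psi>"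
  moreover have r: "reflection \<alpha> \<beta> \<in> \<Phi>"
    using assms component_subset reflection_in_roots by blast
  ultimately have "\<beta> \<bullet> reflection \<alpha> \<beta> = 0" "\<alpha> \<bullet> reflection \<alpha> \<beta> = 0"
    using component_orthogonal assms by blast+
  then have "reflection \<alpha> \<beta> \<bullet> reflection \<alpha> \<beta> = 0"
    by (metis inner_commute inner_reflection reflection_reflection reflection_orthogonal)
  then show False
    using r zero_notin_roots by simp
qed

lemma uminus_in_component: "\<alpha> \<in> \<Psi> \<Longrightarrow> - \<alpha> \<in> \<Psi>"
  using reflection_in_component[of \<alpha> \<alpha>] reflection_self[of \<alpha>] component_subset zero_notin_roots
  by force

lemma coef_outside:
  assumes \<beta>: "\<beta> \<in> \<Psi>" and "\<alpha> \<in> \<Delta>" "\<alpha> \<notin> \<Psi>"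
  shows "coef \<alpha> \<beta> = 0"
proof -
  have orth: "\<gamma> \<bullet> \<delta> = 0" if "\<gamma> \<in> \<Delta> \<inter> \<Psi>" "\<delta> \<in> \<Delta> - \<Psi>" for \<gamma> \<delta>
    using component_orthogonal that base_subset by blast
  then have "(\<forall>\<alpha>\<in>\<Delta> \<inter> \<Psi>. coef \<alpha> \<beta> = 0) \<or> (\<forall>\<alpha>\<in>\<Delta> - \<Psi>. coef \<alpha> \<beta> = 0)"
    using \<beta> component_subset by (intro pure_support) auto
  moreover have False if 0: "\<forall>\<alpha>\<in>\<Delta> \<inter> \<Psi>. coef \<alpha> \<beta> = 0"
  proof -
    have "coef \<alpha> \<beta> * (\<alpha> \<bullet> \<beta>) = 0" if "\<alpha> \<in> \<Delta>" for \<alpha>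
      using 0 that component_orthogonal[OF \<beta>, of \<alpha>] base_subset
      by (cases "\<alpha> \<in> \<Psi>") (auto simp: inner_commute)
    moreover have "\<beta> \<in> span \<Phi>"
      using \<beta> component_subset span_base by blast
    ultimately have "\<beta> \<bullet> \<beta> = 0"
      unfolding inner_expansion[OF \<open>\<beta> \<in> span \<Phi>\<close>] by (intro sum.neutral) blast
    then show False
      using \<beta> component_subset zero_notin_roots by auto
  qed
  ultimately show ?thesis
    using assms by blast
qed

lemma component_expansion:
  assumes "\<beta> \<in> \<Psi>"
  shows "\<beta> = (\<Sum>\<alpha>\<in>\<Delta> \<inter> \<Psi>. coef \<alpha> \<beta> *\<^sub>R \<alpha>)"
proof -
  have "\<beta> = (\<Sum>\<alpha>\<in>\<Delta>. coef \<alpha> \<beta> *\<^sub>R \<alpha>)"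
    using assms component_subset by (intro coef_expansion span_base) auto
  also have "\<dots> = (\<Sum>\<alpha>\<in>\<Delta> \<inter> \<Psi>. coef \<alpha> \<beta> *\<^sub>R \<alpha>)"
    using finite_base coef_outside[OF assms] by (intro sum.mono_neutral_right) auto
  finally show ?thesis .
qed

lemma component_inner:
  assumes "\<beta> \<in> \<Psi>"
  shows "\<beta> \<bullet> y = (\<Sum>\<alpha>\<in>\<Delta> \<inter> \<Psi>. coef \<alpha> \<beta> * (\<alpha> \<bullet> y))"
  by (subst component_expansion[OF assms]) (simp add: inner_sum_left)

lemma component_pure_support:
  assumes "S \<union> T = \<Delta> \<inter> \<Psi>" "S \<inter> T = {}" "\<And>s t. s \<in> S \<Longrightarrow> t \<in> T \<Longrightarrow> s \<bullet> t = 0"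
    and \<beta>: "\<beta> \<in> \<Psi>"
  shows "(\<forall>\<alpha>\<in>S. coef \<alpha> \<beta> = 0) \<or> (\<forall>\<alpha>\<in>T. coef \<alpha> \<beta> = 0)"
proof -
  have "s \<bullet> t = 0" if "s \<in> S" "t \<in> T \<union> (\<Delta> - \<Psi>)" for s t
    using that assms(1,3) component_orthogonal[of s t] base_subset by blast
  then have "(\<forall>\<alpha>\<in>S. coef \<alpha> \<beta> = 0) \<or> (\<forall>\<alpha>\<in>T \<union> (\<Delta> - \<Psi>). coef \<alpha> \<beta> = 0)"
    using assms component_subset by (intro pure_support) blast+
  then show ?thesis
    by blast
qed

lemma base_indecomposable:
  assumes ST: "S \<union> T = \<Delta> \<inter> \<Psi>" "S \<inter> T = {}" "\<And>s t. s \<in> S \<Longrightarrow> t \<in> T \<Longrightarrow> s \<bullet> t = 0"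
    and "S \<noteq> {}"
  shows "T = {}"
proof (rule ccontr)
  assume "T \<noteq> {}"
  define A where "A = {\<beta>\<in>\<Psi>. \<forall>\<alpha>\<in>T. coef \<alpha> \<beta> = 0}"
  define B where "B = {\<beta>\<in>\<Psi>. \<not> (\<forall>\<alpha>\<in>T. coef \<alpha> \<beta> = 0)}"
  have "a \<bullet> b = 0" if a: "a \<in> A" and b: "b \<in> B" for a b
  proof -
    have bS: "\<forall>\<alpha>\<in>S. coef \<alpha> b = 0"
      using component_pure_support[OF ST, of b] b unfolding B_def by blast
    have "coef \<alpha> a * (\<alpha> \<bullet> b) = 0" if \<alpha>: "\<alpha> \<in> \<Delta> \<inter> \<Psi>" for \<alpha>
    proof (cases "\<alpha> \<in> T")
      case True
      then show ?thesis
        using a A_def by simp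
    next
      case False
      then have "\<alpha> \<in> S"
        using \<alpha> ST(1) by blast
      have "b \<bullet> \<alpha> = (\<Sum>\<gamma>\<in>\<Delta> \<inter> \<Psi>. coef \<gamma> b * (\<gamma> \<bullet> \<alpha>))"
        using b B_def by (intro component_inner) simp
      also have "\<dots> = 0"
      proof (intro sum.neutral ballI)
        fix \<gamma> assume "\<gamma> \<in> \<Delta> \<inter> \<Psi>"
        then consider "\<gamma> \<in> S" | "\<gamma> \<in> T"
          using ST(1) by blast
        then show "coef \<gamma> b * (\<gamma> \<bullet> \<alpha>) = 0"
          using bS ST(3)[OF \<open>\<alpha> \<in> S\<close>, of \<gamma>] by cases (simp_all add: inner_commute)
      qed
      finally show ?thesis
        by (simp add: inner_commute)
    qed
    moreover have "a \<in> \<Psi>"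
      using a A_def by simp
    ultimately show ?thesis
      unfolding component_inner[OF \<open>a \<in> \<Psi>\<close>] by (intro sum.neutral) blast
  qed
  moreover have "A \<noteq> {}" "B \<noteq> {}"
  proof -
    obtain s t where st: "s \<in> S" "t \<in> T"
      using \<open>S \<noteq> {}\<close> \<open>T \<noteq> {}\<close> by blast
    then have "s \<in> \<Delta> \<inter> \<Psi>" "s \<notin> T" "t \<in> \<Delta> \<inter> \<Psi>"
      using ST(1,2) by blast+
    then have "s \<in> A" "t \<in> B"
      using \<open>t \<in> T\<close> unfolding A_def B_def by (auto simp: coef_base)
    then show "A \<noteq> {}" "B \<noteq> {}"
      by auto
  qed
  moreover have "A \<union> B = \<Psi>" "A \<inter> B = {}"
    unfolding A_def B_def by auto
  ultimately show False
    using component_irreducible unfolding irreducible_roots_def by blast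
qed

definition root_le :: "'a \<Rightarrow> 'a \<Rightarrow> bool" where
  "root_le \<beta> \<gamma> \<longleftrightarrow> (\<forall>\<alpha>\<in>\<Delta> \<inter> \<Psi>. coef \<alpha> \<beta> \<le> coef \<alpha> \<gamma>)"

definition maximal_root :: "'a \<Rightarrow> bool" where
  "maximal_root \<theta> \<longleftrightarrow> \<theta> \<in> \<Psi> \<and> (\<forall>\<gamma>\<in>\<Psi>. root_le \<theta> \<gamma> \<longrightarrow> \<gamma> = \<theta>)"

lemma root_le_antisym:
  assumes "\<beta> \<in> \<Psi>" "\<gamma> \<in> \<Psi>" "root_le \<beta> \<gamma>" "root_le \<gamma> \<beta>"
  shows "\<beta> = \<gamma>"
proof -
  have "(\<Sum>\<alpha>\<in>\<Delta> \<inter> \<Psi>. coef \<alpha> \<beta> *\<^sub>R \<alpha>) = (\<Sum>\<alpha>\<in>\<Delta> \<inter> \<Psi>. coef \<alpha> \<gamma> *\<^sub>R \<alpha>)"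
    using assms(3,4) unfolding root_le_def by (intro sum.cong) (auto intro: antisym)
  then show ?thesis
    using component_expansion assms(1,2) by metis
qed

lemma component_height: "\<beta> \<in> \<Psi> \<Longrightarrow> height \<beta> = (\<Sum>\<alpha>\<in>\<Delta> \<inter> \<Psi>. coef \<alpha> \<beta>)"
  unfolding height_def using finite_base coef_outside
  by (intro sum.mono_neutral_right) auto

lemma ex_maximal_root_above:
  assumes "\<beta> \<in> \<Psi>"
  obtains \<theta> where "maximal_root \<theta>" "root_le \<beta> \<theta>"
proof -
  have "finite {\<gamma>\<in>\<Psi>. root_le \<beta> \<gamma>}" "{\<gamma>\<in>\<Psi>. root_le \<beta> \<gamma>} \<noteq> {}"
    using finite_component assms unfolding root_le_def by auto
  then have "\<exists>\<theta>\<in>{\<gamma>\<in>\<Psi>. root_le \<beta> \<gamma>}. \<forall>\<gamma>\<in>{\<gamma>\<in>\<Psi>. root_le \<beta> \<gamma>}. height \<gamma> \<le> height \<theta>"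
    by (rule finite_ex_max)
  then obtain \<theta> where \<theta>: "\<theta> \<in> \<Psi>" "root_le \<beta> \<theta>"
    and max: "\<And>\<gamma>. \<gamma> \<in> \<Psi> \<Longrightarrow> root_le \<beta> \<gamma> \<Longrightarrow> height \<gamma> \<le> height \<theta>"
    by blast
  have "\<gamma> = \<theta>" if \<gamma>: "\<gamma> \<in> \<Psi>" "root_le \<theta> \<gamma>" for \<gamma>
  proof -
    have "root_le \<beta> \<gamma>"
      using \<theta>(2) \<gamma>(2) unfolding root_le_def by (meson order_trans)
    then have "(\<Sum>\<alpha>\<in>\<Delta> \<inter> \<Psi>. coef \<alpha> \<gamma>) \<le> (\<Sum>\<alpha>\<in>\<Delta> \<inter> \<Psi>. coef \<alpha> \<theta>)"
      using max[OF \<gamma>(1)] \<gamma>(1) \<theta>(1) component_height by simp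
    moreover have "(\<Sum>\<alpha>\<in>\<Delta> \<inter> \<Psi>. coef \<alpha> \<theta>) \<le> (\<Sum>\<alpha>\<in>\<Delta> \<inter> \<Psi>. coef \<alpha> \<gamma>)"
      using \<gamma>(2) unfolding root_le_def by (intro sum_mono) auto
    ultimately have "(\<Sum>\<alpha>\<in>\<Delta> \<inter> \<Psi>. coef \<alpha> \<gamma> - coef \<alpha> \<theta>) = 0"
      by (simp add: sum_subtractf)
    then have "\<forall>\<alpha>\<in>\<Delta> \<inter> \<Psi>. coef \<alpha> \<gamma> - coef \<alpha> \<theta> = 0"
      using sum_nonneg_eq_0_iff[of "\<Delta> \<inter> \<Psi>" "\<lambda>\<alpha>. coef \<alpha> \<gamma> - coef \<alpha> \<theta>"] \<gamma>(2) finite_base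
      unfolding root_le_def by simp
    then have "root_le \<gamma> \<theta>"
      unfolding root_le_def by auto
    then show ?thesis
      using root_le_antisym \<gamma> \<theta>(1) by blast
  qed
  then show thesis
    using that \<theta> unfolding maximal_root_def by blast
qed

lemma maximal_root_dominant:
  assumes "maximal_root \<theta>" "\<alpha> \<in> \<Delta> \<inter> \<Psi>"
  shows "\<theta> \<bullet> \<alpha> \<ge> 0"
proof (rule ccontr)
  assume neg: "\<not> \<theta> \<bullet> \<alpha> \<ge> 0"
  have \<alpha>: "\<alpha> \<in> \<Delta>" "\<alpha> \<in> \<Psi>"
    using assms(2) by auto
  have k: "2 * (\<theta> \<bullet> \<alpha>) / (\<alpha> \<bullet> \<alpha>) < 0"
    using neg base_inner_pos[OF \<alpha>(1)] by (simp add: divide_neg_pos)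
  then have "root_le \<theta> (reflection \<alpha> \<theta>)"
    unfolding root_le_def by (simp add: coef_reflection[OF \<alpha>(1)])
  moreover have "reflection \<alpha> \<theta> \<in> \<Psi>"
    using assms \<alpha> reflection_in_component unfolding maximal_root_def by blast
  ultimately have "reflection \<alpha> \<theta> = \<theta>"
    using assms(1) unfolding maximal_root_def by blast
  then show False
    using neg base_nonzero[OF \<alpha>(1)] by (simp add: reflection_eq_self_iff)
qed

lemma maximal_root_coef_pos:
  assumes \<theta>: "maximal_root \<theta>" and "\<alpha> \<in> \<Delta> \<inter> \<Psi>"
  shows "coef \<alpha> \<theta> > 0"
proof -
  have \<theta>\<Psi>: "\<theta> \<in> \<Psi>" and \<theta>\<Phi>: "\<theta> \<in> \<Phi>"
    using \<theta> component_subset unfolding maximal_root_def by auto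
  have nonneg: "\<forall>\<alpha>\<in>\<Delta>. 0 \<le> coef \<alpha> \<theta>"
  proof (rule ccontr)
    assume "\<not> ?thesis"
    then have nonpos: "\<forall>\<alpha>\<in>\<Delta>. coef \<alpha> \<theta> \<le> 0"
      using coef_roots[OF \<theta>\<Phi>] by blast
    then have "\<theta> \<bullet> \<theta> \<le> 0"
      unfolding component_inner[OF \<theta>\<Psi>] using maximal_root_dominant[OF \<theta>]
      by (intro sum_nonpos mult_nonpos_nonneg) (auto simp: inner_commute)
    then show False
      using \<theta>\<Phi> zero_notin_roots by (metis inner_gt_zero_iff not_less)
  qed
  define S where "S = {\<alpha>\<in>\<Delta> \<inter> \<Psi>. coef \<alpha> \<theta> > 0}"
  define T where "T = {\<alpha>\<in>\<Delta> \<inter> \<Psi>. \<not> coef \<alpha> \<theta> > 0}"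
  obtain \<gamma> where \<gamma>: "\<gamma> \<in> \<Delta>" "coef \<gamma> \<theta> \<noteq> 0"
    using coef_nonzero[OF \<theta>\<Phi>] .
  then have "\<gamma> \<in> S"
    using coef_outside[OF \<theta>\<Psi>, of \<gamma>] nonneg unfolding S_def by force
  then have "S \<noteq> {}"
    by blast
  moreover have "s \<bullet> t = 0" if s: "s \<in> S" and t: "t \<in> T" for s t
  proof (rule ccontr)
    assume "s \<bullet> t \<noteq> 0"
    then have st: "s \<bullet> t < 0"
      using base_inner_nonpos[of s t] s t unfolding S_def T_def by force
    have le: "coef \<alpha> \<theta> * (\<alpha> \<bullet> t) \<le> 0" if "\<alpha> \<in> \<Delta> \<inter> \<Psi>" for \<alpha>
    proof (cases "\<alpha> = t")
      case True
      then show ?thesis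
        using t nonneg unfolding T_def by (simp add: mult_nonpos_nonneg not_less)
    next
      case False
      then show ?thesis
        using base_inner_nonpos[of \<alpha> t] that t nonneg unfolding T_def
        by (simp add: mult_nonneg_nonpos)
    qed
    have "0 < (\<Sum>\<alpha>\<in>\<Delta> \<inter> \<Psi>. - (coef \<alpha> \<theta> * (\<alpha> \<bullet> t)))"
    proof (rule sum_pos2)
      show "0 < - (coef s \<theta> * (s \<bullet> t))"
        using s st unfolding S_def by (simp add: mult_pos_neg)
      show "s \<in> \<Delta> \<inter> \<Psi>"
        using s S_def by simp
      show "finite (\<Delta> \<inter> \<Psi>)"
        using finite_base by simp
    qed (use le in simp)
    then have "\<theta> \<bullet> t < 0"
      unfolding component_inner[OF \<theta>\<Psi>] sum_negf by simp
    then show False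
      using maximal_root_dominant[OF \<theta>, of t] t unfolding T_def by simp
  qed
  ultimately have "T = {}"
    by (intro base_indecomposable[of S T]) (auto simp: S_def T_def)
  then show ?thesis
    using assms(2) unfolding T_def by blast
qed

lemma maximal_root_unique:
  assumes \<theta>: "maximal_root \<theta>" and \<theta>': "maximal_root \<theta>'"
  shows "\<theta> = \<theta>'"
proof (rule ccontr)
  assume ne: "\<theta> \<noteq> \<theta>'"
  have \<Psi>: "\<theta> \<in> \<Psi>" "\<theta>' \<in> \<Psi>" and \<Phi>: "\<theta> \<in> \<Phi>" "\<theta>' \<in> \<Phi>"
    using \<theta> \<theta>' component_subset unfolding maximal_root_def by auto
  have "\<theta> \<bullet> \<theta>' > 0"
  proof -
    have nn: "\<alpha> \<bullet> \<theta>' \<ge> 0" if "\<alpha> \<in> \<Delta> \<inter> \<Psi>" for \<alpha>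
      using maximal_root_dominant[OF \<theta>' that] by (simp add: inner_commute)
    have "\<theta>' \<bullet> \<theta>' \<noteq> 0"
      using \<Phi>(2) zero_notin_roots by auto
    then have "(\<Sum>\<alpha>\<in>\<Delta> \<inter> \<Psi>. coef \<alpha> \<theta>' * (\<alpha> \<bullet> \<theta>')) \<noteq> 0"
      by (simp only: component_inner[OF \<Psi>(2)] not_False_eq_True)
    then obtain \<alpha> where \<alpha>: "\<alpha> \<in> \<Delta> \<inter> \<Psi>" "\<alpha> \<bullet> \<theta>' \<noteq> 0"
      by (elim sum.not_neutral_contains_not_neutral) simp
    have "0 < coef \<alpha> \<theta> * (\<alpha> \<bullet> \<theta>')"
      using maximal_root_coef_pos[OF \<theta> \<alpha>(1)] nn[OF \<alpha>(1)] \<alpha>(2) by simp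
    moreover have "0 \<le> coef \<gamma> \<theta> * (\<gamma> \<bullet> \<theta>')" if "\<gamma> \<in> \<Delta> \<inter> \<Psi>" for \<gamma>
      using maximal_root_coef_pos[OF \<theta> that] nn[OF that] by simp
    ultimately show ?thesis
      unfolding component_inner[OF \<Psi>(1)] using finite_base \<alpha>(1) by (intro sum_pos2) auto
  qed
  then have "\<theta> - \<theta>' \<in> \<Phi>"
    by (rule diff_in_roots[OF \<Phi> ne])
  then have "root_le \<theta>' \<theta> \<or> root_le \<theta> \<theta>'"
    using coef_roots[of "\<theta> - \<theta>'"] unfolding root_le_def by auto
  then show False
    using \<theta> \<theta>' ne \<Psi> unfolding maximal_root_def by blast
qed

lemma diff_nat_combination_iff:
  assumes "\<theta> \<in> \<Psi>" "\<beta> \<in> \<Psi>"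
  shows "(\<exists>n::'a \<Rightarrow> nat. \<theta> - \<beta> = (\<Sum>\<alpha>\<in>\<Delta> \<inter> \<Psi>. real (n \<alpha>) *\<^sub>R \<alpha>)) \<longleftrightarrow> root_le \<beta> \<theta>"
proof
  assume "\<exists>n::'a \<Rightarrow> nat. \<theta> - \<beta> = (\<Sum>\<alpha>\<in>\<Delta> \<inter> \<Psi>. real (n \<alpha>) *\<^sub>R \<alpha>)"
  then obtain n :: "'a \<Rightarrow> nat" where n: "\<theta> - \<beta> = (\<Sum>\<alpha>\<in>\<Delta> \<inter> \<Psi>. real (n \<alpha>) *\<^sub>R \<alpha>)"
    by blast
  have "coef \<alpha> \<theta> - coef \<alpha> \<beta> \<ge> 0" if "\<alpha> \<in> \<Delta> \<inter> \<Psi>" for \<alpha>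
    using coef_sum_base[of \<alpha> "\<Delta> \<inter> \<Psi>" "\<lambda>\<alpha>. real (n \<alpha>)"] that unfolding n[symmetric] by simp
  then show "root_le \<beta> \<theta>"
    unfolding root_le_def by simp
next
  assume le: "root_le \<beta> \<theta>"
  have "real (nat \<lfloor>coef \<alpha> \<theta> - coef \<alpha> \<beta>\<rfloor>) = coef \<alpha> \<theta> - coef \<alpha> \<beta>" if "\<alpha> \<in> \<Delta> \<inter> \<Psi>" for \<alpha>
  proof -
    have "coef \<alpha> \<theta> - coef \<alpha> \<beta> \<in> \<int>"
      using coef_roots assms component_subset that by (metis IntD1 Ints_diff subsetD)
    then show ?thesis
      using le that unfolding root_le_def by (auto elim!: Ints_cases)
  qed
  then have "(\<Sum>\<alpha>\<in>\<Delta> \<inter> \<Psi>. real (nat \<lfloor>coef \<alpha> \<theta> - coef \<alpha> \<beta>\<rfloor>) *\<^sub>R \<alpha>)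
      = (\<Sum>\<alpha>\<in>\<Delta> \<inter> \<Psi>. coef \<alpha> \<theta> *\<^sub>R \<alpha> - coef \<alpha> \<beta> *\<^sub>R \<alpha>)"
    by (intro sum.cong) (simp_all add: scaleR_diff_left)
  also have "\<dots> = \<theta> - \<beta>"
    unfolding sum_subtractf using component_expansion assms by metis
  finally show "\<exists>n::'a \<Rightarrow> nat. \<theta> - \<beta> = (\<Sum>\<alpha>\<in>\<Delta> \<inter> \<Psi>. real (n \<alpha>) *\<^sub>R \<alpha>)"
    by (intro exI[of _ "\<lambda>\<alpha>. nat \<lfloor>coef \<alpha> \<theta> - coef \<alpha> \<beta>\<rfloor>"]) simp
qed

abbreviation \<theta> :: 'a where
  "\<theta> \<equiv> highest_root \<Delta> \<Psi>"

lemma highest_root_in: "\<theta> \<in> \<Psi>"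
  and highest_root_ge: "\<And>\<beta>. \<beta> \<in> \<Psi> \<Longrightarrow> root_le \<beta> \<theta>"
  and maximal_highest_root: "maximal_root \<theta>"
proof -
  obtain \<beta>0 where "\<beta>0 \<in> \<Psi>"
    using component_irreducible unfolding irreducible_roots_def by blast
  then obtain \<mu> where \<mu>: "maximal_root \<mu>"
    using ex_maximal_root_above by blast
  have \<mu>\<Psi>: "\<mu> \<in> \<Psi>"
    using \<mu> maximal_root_def by blast
  have ge: "root_le \<beta> \<mu>" if "\<beta> \<in> \<Psi>" for \<beta>
    using ex_maximal_root_above[OF that] maximal_root_unique \<mu> by metis
  have "\<theta> = \<mu>"
    unfolding highest_root_def
  proof (rule the_equality)
    show "\<mu> \<in> \<Psi> \<and> (\<forall>\<beta>\<in>\<Psi>. \<exists>n::'a \<Rightarrow> nat. \<mu> - \<beta> = (\<Sum>\<alpha>\<in>\<Delta> \<inter> \<Psi>. real (n \<alpha>) *\<^sub>R \<alpha>))"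
      using \<mu>\<Psi> ge diff_nat_combination_iff by blast
  next
    fix \<nu> assume "\<nu> \<in> \<Psi> \<and> (\<forall>\<beta>\<in>\<Psi>. \<exists>n::'a \<Rightarrow> nat. \<nu> - \<beta> = (\<Sum>\<alpha>\<in>\<Delta> \<inter> \<Psi>. real (n \<alpha>) *\<^sub>R \<alpha>))"
    then show "\<nu> = \<mu>"
      using \<mu>\<Psi> ge diff_nat_combination_iff root_le_antisym by blast
  qed
  then show "\<theta> \<in> \<Psi>" "\<And>\<beta>. \<beta> \<in> \<Psi> \<Longrightarrow> root_le \<beta> \<theta>" "maximal_root \<theta>"
    using \<mu>\<Psi> ge \<mu> by simp_all
qed

lemma coef_le_highest: "\<beta> \<in> \<Psi> \<Longrightarrow> \<alpha> \<in> \<Delta> \<inter> \<Psi> \<Longrightarrow> coef \<alpha> \<beta> \<le> coef \<alpha> \<theta>"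
  using highest_root_ge unfolding root_le_def by blast

lemma highest_root_coeff_eq:
  assumes "\<alpha> \<in> \<Delta> \<inter> \<Psi>"
  shows "highest_root_coeff \<Delta> \<Psi> \<alpha> = coef \<alpha> \<theta>"
proof -
  have "representation (\<Delta> \<inter> \<Psi>) \<theta> = (\<lambda>v. if v \<in> \<Delta> \<inter> \<Psi> then coef v \<theta> else 0)"
  proof (rule representation_eqI)
    show "independent (\<Delta> \<inter> \<Psi>)"
      using independent_base by (rule independent_mono) auto
    show "\<theta> \<in> span (\<Delta> \<inter> \<Psi>)"
      by (subst component_expansion[OF highest_root_in]) (auto intro: span_sum span_scale span_base)
    have fin: "finite (\<Delta> \<inter> \<Psi>)"
      using finite_base by simp
    show "finite {b. (if b \<in> \<Delta> \<inter> \<Psi> then coef b \<theta> else 0) \<noteq> 0}"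
      by (rule finite_subset[OF _ fin]) auto
    have "(\<Sum>b | (if b \<in> \<Delta> \<inter> \<Psi> then coef b \<theta> else 0) \<noteq> 0. (if b \<in> \<Delta> \<inter> \<Psi> then coef b \<theta> else 0) *\<^sub>R b)
        = (\<Sum>b\<in>\<Delta> \<inter> \<Psi>. coef b \<theta> *\<^sub>R b)"
      using fin by (intro sum.mono_neutral_cong_left) auto
    then show "(\<Sum>b | (if b \<in> \<Delta> \<inter> \<Psi> then coef b \<theta> else 0) \<noteq> 0. (if b \<in> \<Delta> \<inter> \<Psi> then coef b \<theta> else 0) *\<^sub>R b) = \<theta>"
      using component_expansion[OF highest_root_in] by simp
  qed (auto split: if_splits)
  then show ?thesis
    using assms unfolding highest_root_coeff_def by simp
qed

lemma inner_o_vec: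
  assumes "\<alpha> \<in> \<Delta> \<inter> \<Psi>"
  shows "x \<bullet> o_vec \<Phi> \<Delta> \<Psi> \<alpha> = coef \<alpha> x / coef \<alpha> \<theta>"
  using highest_root_coeff_eq[OF assms] by (simp add: o_vec_def coef_def)

lemma inner_o_vec_le:
  assumes "\<alpha> \<in> \<Delta> \<inter> \<Psi>" "\<beta> \<in> \<Psi>"
  shows "\<beta> \<bullet> o_vec \<Phi> \<Delta> \<Psi> \<alpha> \<le> 1"
    and "\<beta> \<bullet> o_vec \<Phi> \<Delta> \<Psi> \<alpha> = 1 \<longleftrightarrow> coef \<alpha> \<beta> = coef \<alpha> \<theta>"
  using maximal_root_coef_pos[OF maximal_highest_root assms(1)] coef_le_highest[OF assms(2,1)]
    inner_o_vec[OF assms(1), of \<beta>] by auto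

section \<open>Extremal subsets\<close>

definition top_roots :: "'a set \<Rightarrow> 'a set" where
  "top_roots I = {\<beta>\<in>\<Psi>. \<forall>\<alpha>\<in>I. coef \<alpha> \<beta> = coef \<alpha> \<theta>}"

lemma uminus_highest_notin_base: "- \<theta> \<notin> \<Delta>"
proof
  assume "- \<theta> \<in> \<Delta>"
  then have "- \<theta> \<in> \<Delta> \<inter> \<Psi>" and "coef (- \<theta>) (- \<theta>) = 1"
    using uminus_in_component[OF highest_root_in] coef_base[of "- \<theta>" "- \<theta>"] by simp_all
  then show False
    using maximal_root_coef_pos[OF maximal_highest_root, of "- \<theta>"] by simp
qed

lemma inner_diff_highest:
  assumes "\<beta> \<in> \<Psi>"
  shows "\<beta> \<bullet> y - \<theta> \<bullet> y = (\<Sum>\<gamma>\<in>\<Delta> \<inter> \<Psi>. (coef \<gamma> \<beta> - coef \<gamma> \<theta>) * (\<gamma> \<bullet> y))"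
  unfolding component_inner[OF assms] component_inner[OF highest_root_in]
  by (simp add: sum_subtractf left_diff_distrib)

text \<open>
  Walking along a path starting at the affine vertex, reflections lower the coefficients of
  the simple roots on the path one after the other.
\<close>

lemma extremal_eq:
  assumes I: "extremal \<Delta> \<Psi> I"
  shows "I = {\<alpha>\<in>\<Delta> \<inter> \<Psi>. \<forall>\<beta>\<in>top_roots I. coef \<alpha> \<beta> = coef \<alpha> \<theta>}"
proof
  have sub: "I \<subseteq> \<Delta> \<inter> \<Psi>"
    using I unfolding extremal_def by blast
  then show "I \<subseteq> {\<alpha>\<in>\<Delta> \<inter> \<Psi>. \<forall>\<beta>\<in>top_roots I. coef \<alpha> \<beta> = coef \<alpha> \<theta>}"
    unfolding top_roots_def by blast
  define V where "V = extended_simple_roots \<Delta> \<Psi> - I"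
  define E where "E = {(a, b). a \<in> V \<and> b \<in> V \<and> a \<noteq> b \<and> a \<bullet> b \<noteq> 0}"
  have lowered: "v = - \<theta> \<or> (\<exists>\<beta>\<in>top_roots I. coef v \<beta> < coef v \<theta>)" if "(- \<theta>, v) \<in> E\<^sup>*" for v
    using that
  proof (induction rule: rtrancl_induct)
    case base
    then show ?case by simp
  next
    case (step y z)
    have yz: "y \<in> V" "z \<in> V" "y \<noteq> z" "y \<bullet> z \<noteq> 0"
      using step.hyps(2) unfolding E_def by auto
    show ?case
    proof (rule ccontr)
      assume neg: "\<not> ?case"
      then have "z \<noteq> - \<theta>"
        by blast
      then have z: "z \<in> \<Delta>" "z \<in> \<Psi>" "z \<notin> I"
        using yz(2) unfolding V_def extended_simple_roots_def by auto
      have top: "coef z \<beta> = coef z \<theta>" if "\<beta> \<in> top_roots I" for \<beta>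
        using neg that coef_le_highest[of \<beta> z] z unfolding top_roots_def by force
      have term_nonneg: "0 \<le> (coef \<gamma> \<beta> - coef \<gamma> \<theta>) * (\<gamma> \<bullet> z)"
        if "\<beta> \<in> top_roots I" "\<gamma> \<in> \<Delta> \<inter> \<Psi>" for \<beta> \<gamma>
      proof (cases "\<gamma> = z")
        case True
        then show ?thesis
          using top[OF that(1)] by simp
      next
        case False
        then show ?thesis
          using base_inner_nonpos[of \<gamma> z] coef_le_highest[of \<beta> \<gamma>] that z(1)
          unfolding top_roots_def by (simp add: mult_nonpos_nonpos)
      qed
      have \<theta>z: "\<theta> \<bullet> z \<ge> 0"
        using maximal_root_dominant[OF maximal_highest_root, of z] z by simp
      obtain \<beta> where \<beta>: "\<beta> \<in> top_roots I" "\<beta> \<bullet> z > 0"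
      proof (cases "y = - \<theta>")
        case True
        have "\<theta> \<in> top_roots I"
          using highest_root_in unfolding top_roots_def by simp
        then show thesis
          using that \<theta>z yz(4) True by simp
      next
        case False
        then obtain \<beta> where \<beta>: "\<beta> \<in> top_roots I" "coef y \<beta> < coef y \<theta>"
          using step.IH by blast
        have y: "y \<in> \<Delta> \<inter> \<Psi>"
          using False yz(1) unfolding V_def extended_simple_roots_def by auto
        then have "y \<bullet> z < 0"
          using base_inner_nonpos[of y z] yz z by simp
        then have "0 < (coef y \<beta> - coef y \<theta>) * (y \<bullet> z)"
          using \<beta>(2) by (simp add: mult_neg_neg)
        then have "0 < (\<Sum>\<gamma>\<in>\<Delta> \<inter> \<Psi>. (coef \<gamma> \<beta> - coef \<gamma> \<theta>) * (\<gamma> \<bullet> z))"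
          using y finite_base term_nonneg[OF \<beta>(1)] by (intro sum_pos2[where i = y]) auto
        moreover have "\<beta> \<in> \<Psi>"
          using \<beta>(1) top_roots_def by simp
        ultimately have "\<beta> \<bullet> z > 0"
          using inner_diff_highest[of \<beta> z] \<theta>z by linarith
        then show thesis
          using that \<beta>(1) by blast
      qed
      have k: "2 * (\<beta> \<bullet> z) / (z \<bullet> z) > 0"
        using \<beta>(2) base_inner_pos[OF z(1)] by simp
      have "reflection z \<beta> \<in> top_roots I"
        using \<beta>(1) z reflection_in_component unfolding top_roots_def
        by (auto simp: coef_reflection[OF z(1)])
      then have "coef z (reflection z \<beta>) = coef z \<beta>"
        using top \<beta>(1) by metis
      then show False
        using k unfolding coef_reflection[OF z(1)] by auto
    qed
  qed
  show "{\<alpha>\<in>\<Delta> \<inter> \<Psi>. \<forall>\<beta>\<in>top_roots I. coef \<alpha> \<beta> = coef \<alpha> \<theta>} \<subseteq> I"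
  proof (rule subsetI, rule ccontr)
    fix \<alpha> assume \<alpha>: "\<alpha> \<in> {\<alpha>\<in>\<Delta> \<inter> \<Psi>. \<forall>\<beta>\<in>top_roots I. coef \<alpha> \<beta> = coef \<alpha> \<theta>}" "\<alpha> \<notin> I"
    then have "\<alpha> \<in> V" "- \<theta> \<in> V"
      using sub uminus_highest_notin_base unfolding V_def extended_simple_roots_def by auto
    then have "(- \<theta>, \<alpha>) \<in> E\<^sup>*"
      using I unfolding extremal_def diagram_connected_def V_def[symmetric] E_def by blast
    then show False
      using lowered[of \<alpha>] \<alpha>(1) uminus_highest_notin_base by auto
  qed
qed

lemma extremal_unique:
  assumes "extremal \<Delta> \<Psi> I" "extremal \<Delta> \<Psi> J" "top_roots I = top_roots J"
  shows "I = J"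
proof -
  have "I = {\<alpha>\<in>\<Delta> \<inter> \<Psi>. \<forall>\<beta>\<in>top_roots J. coef \<alpha> \<beta> = coef \<alpha> \<theta>}"
    unfolding assms(3)[symmetric] by (rule extremal_eq[OF assms(1)])
  also have "\<dots> = J"
    by (rule extremal_eq[OF assms(2), symmetric])
  finally show ?thesis .
qed

text \<open>
  Simple roots outside \<open>I\<close> that are not connected to the affine vertex never occur in
  \<open>\<theta> - \<beta>\<close>: a counterexample \<open>\<beta>\<close> of greatest height is raised by a simple reflection to a
  root fixed by that reflection.
\<close>

lemma top_roots_eq:
  assumes KL: "K \<union> L = \<Delta> \<inter> \<Psi> - I" "K \<inter> L = {}" "I \<subseteq> \<Delta> \<inter> \<Psi>"
    and orth: "\<And>k l. k \<in> K \<Longrightarrow> l \<in> L \<Longrightarrow> k \<bullet> l = 0" "\<And>l. l \<in> L \<Longrightarrow> \<theta> \<bullet> l = 0"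
  shows "top_roots (\<Delta> \<inter> \<Psi> - K) = top_roots I"
proof
  have fin: "finite L"
    using KL(1) finite_base by (metis Un_subset_iff finite_Diff finite_Int finite_subset subset_refl)
  have L: "l \<in> \<Delta>" "l \<in> \<Psi>" "l \<notin> I" if "l \<in> L" for l
    using that KL(1) by auto
  show "top_roots (\<Delta> \<inter> \<Psi> - K) \<subseteq> top_roots I"
    using KL unfolding top_roots_def by blast
  have inner: "\<beta> \<bullet> l = - ((\<Sum>\<gamma>\<in>L. (coef \<gamma> \<theta> - coef \<gamma> \<beta>) *\<^sub>R \<gamma>) \<bullet> l)"
    if \<beta>: "\<beta> \<in> top_roots I" and l: "l \<in> L" for \<beta> l
  proof -
    have "\<beta> \<in> \<Psi>"
      using \<beta> top_roots_def by simp
    then have "\<beta> \<bullet> l = (\<Sum>\<gamma>\<in>\<Delta> \<inter> \<Psi>. (coef \<gamma> \<beta> - coef \<gamma> \<theta>) * (\<gamma> \<bullet> l))"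
      using inner_diff_highest[of \<beta> l] orth(2)[OF l] by simp
    also have "\<dots> = (\<Sum>\<gamma>\<in>L. (coef \<gamma> \<beta> - coef \<gamma> \<theta>) * (\<gamma> \<bullet> l))"
    proof (rule sum.mono_neutral_right)
      show "\<forall>\<gamma>\<in>\<Delta> \<inter> \<Psi> - L. (coef \<gamma> \<beta> - coef \<gamma> \<theta>) * (\<gamma> \<bullet> l) = 0"
      proof
        fix \<gamma> assume "\<gamma> \<in> \<Delta> \<inter> \<Psi> - L"
        then consider "\<gamma> \<in> I" | "\<gamma> \<in> K"
          using KL(1) by blast
        then show "(coef \<gamma> \<beta> - coef \<gamma> \<theta>) * (\<gamma> \<bullet> l) = 0"
          using \<beta> orth(1)[OF _ l] unfolding top_roots_def by cases simp_all
      qed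
    qed (use L finite_base in auto)
    also have "\<dots> = - ((\<Sum>\<gamma>\<in>L. (coef \<gamma> \<theta> - coef \<gamma> \<beta>) *\<^sub>R \<gamma>) \<bullet> l)"
      unfolding inner_sum_left sum_negf[symmetric] by (intro sum.cong) (simp_all add: algebra_simps)
    finally show ?thesis .
  qed
  define M where "M = {\<beta>\<in>top_roots I. \<exists>l\<in>L. coef l \<beta> \<noteq> coef l \<theta>}"
  have "M = {}"
  proof (rule ccontr)
    assume "M \<noteq> {}"
    moreover have "finite M"
      by (rule finite_subset[OF _ finite_component]) (auto simp: M_def top_roots_def)
    ultimately have "\<exists>\<beta>\<in>M. \<forall>\<gamma>\<in>M. height \<gamma> \<le> height \<beta>"
      by (intro finite_ex_max)
    then obtain \<beta> where \<beta>M: "\<beta> \<in> M" and max: "\<And>\<gamma>. \<gamma> \<in> M \<Longrightarrow> height \<gamma> \<le> height \<beta>"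
      by blast
    have \<beta>: "\<beta> \<in> top_roots I" "\<beta> \<in> \<Psi>"
      using \<beta>M unfolding M_def top_roots_def by auto
    define \<delta> where "\<delta> = (\<Sum>\<gamma>\<in>L. (coef \<gamma> \<theta> - coef \<gamma> \<beta>) *\<^sub>R \<gamma>)"
    obtain l0 where l0: "l0 \<in> L" "coef l0 \<beta> \<noteq> coef l0 \<theta>"
      using \<beta>M M_def by blast
    have "coef l0 \<delta> = coef l0 \<theta> - coef l0 \<beta>"
      unfolding \<delta>_def using coef_sum_base[of l0 L "\<lambda>\<gamma>. coef \<gamma> \<theta> - coef \<gamma> \<beta>"] l0(1) L by auto
    then have "\<delta> \<noteq> 0"
      using l0(2) by auto
    then have "0 < \<delta> \<bullet> \<delta>"
      by simp
    also have "\<delta> \<bullet> \<delta> = (\<Sum>\<gamma>\<in>L. (coef \<gamma> \<theta> - coef \<gamma> \<beta>) * (\<gamma> \<bullet> \<delta>))"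
      by (subst \<delta>_def) (simp add: inner_sum_left)
    finally obtain l where l: "l \<in> L" "(coef l \<theta> - coef l \<beta>) * (l \<bullet> \<delta>) > 0"
      by (meson not_less sum_nonpos)
    have l\<Delta>: "l \<in> \<Delta>"
      using L l(1) by blast
    have "l \<bullet> \<delta> > 0"
      using l coef_le_highest[OF \<beta>(2), of l] L[OF l(1)] by (simp add: zero_less_mult_iff)
    then have neg: "\<beta> \<bullet> l < 0"
      using inner[OF \<beta>(1) l(1)] \<delta>_def by (simp add: inner_commute)
    define \<beta>' where "\<beta>' = reflection l \<beta>"
    have \<beta>': "\<beta>' \<in> top_roots I"
      using \<beta> reflection_in_component[of l \<beta>] L[OF l(1)] coef_reflection[OF l\<Delta>]
      unfolding \<beta>'_def top_roots_def by auto
    have "2 * (\<beta> \<bullet> l) / (l \<bullet> l) < 0"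
      using neg base_inner_pos[OF l\<Delta>] by (simp add: divide_neg_pos)
    then have higher: "height \<beta> < height \<beta>'"
      unfolding \<beta>'_def height_reflection[OF l\<Delta>] by simp
    then have "\<beta>' \<notin> M"
      using max by force
    then have "\<forall>\<gamma>\<in>L. coef \<gamma> \<beta>' = coef \<gamma> \<theta>"
      using \<beta>' M_def by blast
    then have "(\<Sum>\<gamma>\<in>L. (coef \<gamma> \<theta> - coef \<gamma> \<beta>') *\<^sub>R \<gamma>) = 0"
      by (intro sum.neutral) simp
    then have "\<beta>' \<bullet> l = 0"
      using inner[OF \<beta>' l(1)] by simp
    then have "\<beta>' = \<beta>"
      using reflection_orthogonal reflection_reflection \<beta>'_def by metis
    then show False
      using higher by simp
  qed
  show "top_roots I \<subseteq> top_roots (\<Delta> \<inter> \<Psi> - K)"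
  proof
    fix \<beta> assume \<beta>: "\<beta> \<in> top_roots I"
    have "coef \<alpha> \<beta> = coef \<alpha> \<theta>" if "\<alpha> \<in> \<Delta> \<inter> \<Psi> - K" for \<alpha>
    proof (cases "\<alpha> \<in> I")
      case True
      then show ?thesis
        using \<beta> top_roots_def by simp
    next
      case False
      then have "\<alpha> \<in> L"
        using that KL(1) by blast
      then show ?thesis
        using \<beta> \<open>M = {}\<close> unfolding M_def by blast
    qed
    then show "\<beta> \<in> top_roots (\<Delta> \<inter> \<Psi> - K)"
      using \<beta> unfolding top_roots_def by blast
  qed
qed

lemma ex_extremal:
  assumes I: "I \<subseteq> \<Delta> \<inter> \<Psi>"
  shows "\<exists>J. extremal \<Delta> \<Psi> J \<and> top_roots J = top_roots I"
proof -
  define V where "V = extended_simple_roots \<Delta> \<Psi> - I"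
  define E where "E = {(a, b). a \<in> V \<and> b \<in> V \<and> a \<noteq> b \<and> a \<bullet> b \<noteq> 0}"
  define K where "K = {\<alpha>\<in>\<Delta> \<inter> \<Psi> - I. (- \<theta>, \<alpha>) \<in> E\<^sup>*}"
  define L where "L = {\<alpha>\<in>\<Delta> \<inter> \<Psi> - I. (- \<theta>, \<alpha>) \<notin> E\<^sup>*}"
  define J where "J = \<Delta> \<inter> \<Psi> - K"
  have V: "V = insert (- \<theta>) (\<Delta> \<inter> \<Psi> - I)"
    using I uminus_highest_notin_base unfolding V_def extended_simple_roots_def by blast
  have V_minus: "extended_simple_roots \<Delta> \<Psi> - J = insert (- \<theta>) K"
    using uminus_highest_notin_base unfolding J_def extended_simple_roots_def K_def by blast
  define E' where "E' = {(a, b). a \<in> insert (- \<theta>) K \<and> b \<in> insert (- \<theta>) K \<and> a \<noteq> b \<and> a \<bullet> b \<noteq> 0}"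
  have reach: "(- \<theta>, v) \<in> E'\<^sup>*" if "(- \<theta>, v) \<in> E\<^sup>*" for v
    using that
  proof (induction rule: rtrancl_induct)
    case base
    then show ?case by simp
  next
    case (step y z)
    have "y \<in> V" "z \<in> V"
      using step.hyps(2) unfolding E_def by auto
    then have "y \<in> insert (- \<theta>) K" "z \<in> insert (- \<theta>) K"
      using step.hyps(1) rtrancl_into_rtrancl[OF step.hyps] by (simp_all add: K_def V)
    moreover have "y \<noteq> z" "y \<bullet> z \<noteq> 0"
      using step.hyps(2) unfolding E_def by auto
    ultimately have "(y, z) \<in> E'"
      unfolding E'_def by simp
    with step.IH show ?case
      by (rule rtrancl_into_rtrancl)
  qed
  have "sym E'"
    unfolding E'_def sym_def by (auto simp: inner_commute)
  then have "sym (E'\<^sup>*)"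
    by (rule sym_rtrancl)
  moreover have "(- \<theta>, v) \<in> E'\<^sup>*" if "v \<in> insert (- \<theta>) K" for v
  proof (rule reach)
    show "(- \<theta>, v) \<in> E\<^sup>*"
      using that unfolding K_def by (elim insertE) simp_all
  qed
  ultimately have "(u, v) \<in> E'\<^sup>*" if "u \<in> insert (- \<theta>) K" "v \<in> insert (- \<theta>) K" for u v
    using that by (metis rtrancl_trans symD)
  then have "diagram_connected (insert (- \<theta>) K)"
    unfolding diagram_connected_def E'_def[symmetric] by blast
  moreover have "J \<subseteq> \<Delta> \<inter> \<Psi>"
    unfolding J_def by blast
  ultimately have "extremal \<Delta> \<Psi> J"
    unfolding extremal_def V_minus by blast
  moreover have "top_roots J = top_roots I"
    unfolding J_def
  proof (rule top_roots_eq[where L = L])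
    show "K \<union> L = \<Delta> \<inter> \<Psi> - I" "K \<inter> L = {}"
      unfolding K_def L_def by auto
    have not_edge: "a \<bullet> l = 0" if "(- \<theta>, a) \<in> E\<^sup>*" "a \<in> V" "l \<in> L" for a l
    proof (rule ccontr)
      assume "a \<bullet> l \<noteq> 0"
      moreover have "l \<in> V"
        using that unfolding L_def V by blast
      moreover have "a \<noteq> l"
        using that unfolding L_def by blast
      ultimately have "(a, l) \<in> E"
        using that unfolding E_def by blast
      then show False
        using that rtrancl_into_rtrancl[of "- \<theta>" a E l] unfolding L_def by blast
    qed
    show "k \<bullet> l = 0" if "k \<in> K" "l \<in> L" for k l
      using not_edge[of k l] that unfolding K_def V by blast
    show "\<theta> \<bullet> l = 0" if "l \<in> L" for l
      using not_edge[of "- \<theta>" l] that unfolding V by simp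
  qed (fact I)
  ultimately show ?thesis
    by blast
qed

lemma coef_off_component:
  assumes "\<beta> \<in> \<Phi>" "\<beta> \<notin> \<Psi>" and \<alpha>: "\<alpha> \<in> \<Delta> \<inter> \<Psi>"
  shows "coef \<alpha> \<beta> = 0"
proof -
  have orth: "\<gamma> \<bullet> \<delta> = 0" if "\<gamma> \<in> \<Delta> \<inter> \<Psi>" "\<delta> \<in> \<Delta> - \<Psi>" for \<gamma> \<delta>
    using component_orthogonal that base_subset by blast
  have "(\<forall>\<alpha>\<in>\<Delta> \<inter> \<Psi>. coef \<alpha> \<beta> = 0) \<or> (\<forall>\<alpha>\<in>\<Delta> - \<Psi>. coef \<alpha> \<beta> = 0)"
    using orth assms(1) by (intro pure_support) auto
  moreover have False if 0: "\<forall>\<alpha>\<in>\<Delta> - \<Psi>. coef \<alpha> \<beta> = 0"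
  proof -
    have "coef \<alpha> \<beta> * (\<alpha> \<bullet> \<beta>) = 0" if "\<alpha> \<in> \<Delta>" for \<alpha>
      using 0 that component_orthogonal[OF _ assms(1,2), of \<alpha>] by (cases "\<alpha> \<in> \<Psi>") auto
    then have "\<beta> \<bullet> \<beta> = 0"
      unfolding inner_expansion[OF span_base[OF assms(1)]] by (intro sum.neutral) blast
    then show False
      using assms(1) zero_notin_roots by auto
  qed
  ultimately show ?thesis
    using \<alpha> by blast
qed

lemma zero_in_hull: "0 \<in> convex hull \<Psi>"
proof -
  have "(1/2) *\<^sub>R \<theta> + (1/2) *\<^sub>R (- \<theta>) \<in> convex hull \<Psi>"
    using highest_root_in uminus_in_component
    by (intro convexD[OF convex_convex_hull]) (auto intro: hull_inc)
  then show ?thesis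
    by simp
qed

lemma polytope_Int_span: "root_polytope \<Phi> \<inter> span \<Psi> = convex hull \<Psi>"
proof
  show "convex hull \<Psi> \<subseteq> root_polytope \<Phi> \<inter> span \<Psi>"
    unfolding root_polytope_def using component_subset convex_hull_subset_span
    by (simp add: hull_mono)
  show "root_polytope \<Phi> \<inter> span \<Psi> \<subseteq> convex hull \<Psi>"
  proof
    fix x assume x: "x \<in> root_polytope \<Phi> \<inter> span \<Psi>"
    then obtain u where u: "\<forall>\<beta>\<in>\<Phi>. 0 \<le> u \<beta>" "sum u \<Phi> = 1" "(\<Sum>\<beta>\<in>\<Phi>. u \<beta> *\<^sub>R \<beta>) = x"
      unfolding root_polytope_def convex_hull_finite[OF finite_roots] by auto
    define y where "y = (\<Sum>\<beta>\<in>\<Psi>. u \<beta> *\<^sub>R \<beta>)"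
    have xy: "x - y = (\<Sum>\<beta>\<in>\<Phi> - \<Psi>. u \<beta> *\<^sub>R \<beta>)"
      unfolding y_def u(3)[symmetric] using sum_diff[OF finite_roots component_subset, of "\<lambda>\<beta>. u \<beta> *\<^sub>R \<beta>"]
      by simp
    have "orthogonal (x - y) b" if "b \<in> \<Psi>" for b
    proof -
      have "\<beta> \<bullet> b = 0" if "\<beta> \<in> \<Phi> - \<Psi>" for \<beta>
        using component_orthogonal[OF \<open>b \<in> \<Psi>\<close>, of \<beta>] that by (simp add: inner_commute)
      then show ?thesis
        unfolding orthogonal_def xy inner_sum_left by (intro sum.neutral) simp
    qed
    moreover have "y \<in> span \<Psi>"
      unfolding y_def by (intro span_sum span_scale span_base)
    then have "x - y \<in> span \<Psi>"
      using x by (simp add: span_diff)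
    ultimately have "orthogonal (x - y) (x - y)"
      using orthogonal_to_span by blast
    then have "x = y"
      by (simp add: orthogonal_self)
    have z: "0 \<notin> \<Psi>"
      using component_subset zero_notin_roots by blast
    define v where "v \<beta> = (if \<beta> = 0 then 1 - sum u \<Psi> else u \<beta>)" for \<beta>
    have v: "v \<beta> = u \<beta>" if "\<beta> \<in> \<Psi>" for \<beta>
      using that z unfolding v_def by auto
    have "sum u \<Psi> \<le> 1"
      unfolding u(2)[symmetric] using u(1) component_subset finite_roots by (intro sum_mono2) auto
    then have "\<forall>\<beta>\<in>insert 0 \<Psi>. 0 \<le> v \<beta>"
      using u(1) component_subset unfolding v_def by auto
    moreover have "sum v (insert 0 \<Psi>) = 1"
      using sum.cong[OF refl v, of \<Psi>] z finite_component by (simp add: v_def)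
    moreover have "(\<Sum>\<beta>\<in>insert 0 \<Psi>. v \<beta> *\<^sub>R \<beta>) = x"
      unfolding \<open>x = y\<close> y_def using z finite_component v by simp
    ultimately have "x \<in> convex hull (insert 0 \<Psi>)"
      using finite_component by (subst convex_hull_finite) auto
    then show "x \<in> convex hull \<Psi>"
      using hull_redundant[OF zero_in_hull] by simp
  qed
qed

lemma inner_le_1_hull:
  assumes "x \<in> convex hull \<Psi>" "\<And>\<beta>. \<beta> \<in> \<Psi> \<Longrightarrow> \<beta> \<bullet> g \<le> 1"
  shows "x \<bullet> g \<le> 1"
  using supporting_hull_le[OF assms(2)] assms(1) by blast

lemma o_vec_slice:
  assumes I: "I \<subseteq> \<Delta> \<inter> \<Psi>"
  shows "{x \<in> root_polytope \<Phi> \<inter> span \<Psi>. \<forall>\<alpha>\<in>I. x \<bullet> o_vec \<Phi> \<Delta> \<Psi> \<alpha> = 1} = convex hull (top_roots I)"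
proof (cases "I = {}")
  case True
  then show ?thesis
    unfolding polytope_Int_span top_roots_def by simp
next
  case False
  have fin: "finite I"
    using I finite_base finite_subset by blast
  define g where "g = (1 / real (card I)) *\<^sub>R (\<Sum>\<alpha>\<in>I. o_vec \<Phi> \<Delta> \<Psi> \<alpha>)"
  have g: "x \<bullet> g \<le> 1 \<and> (x \<bullet> g = 1 \<longleftrightarrow> (\<forall>\<alpha>\<in>I. x \<bullet> o_vec \<Phi> \<Delta> \<Psi> \<alpha> = 1))" if "x \<in> convex hull \<Psi>" for x
  proof -
    have "x \<bullet> o_vec \<Phi> \<Delta> \<Psi> \<alpha> \<le> 1" if "\<alpha> \<in> I" for \<alpha>
      using inner_le_1_hull[OF \<open>x \<in> convex hull \<Psi>\<close>] inner_o_vec_le(1)[of \<alpha>] that I by blast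
    then show ?thesis
      using average_le_1[OF fin False, of "\<lambda>\<alpha>. x \<bullet> o_vec \<Phi> \<Delta> \<Psi> \<alpha>"]
      unfolding g_def by (simp add: inner_sum_right)
  qed
  have "{x \<in> root_polytope \<Phi> \<inter> span \<Psi>. \<forall>\<alpha>\<in>I. x \<bullet> o_vec \<Phi> \<Delta> \<Psi> \<alpha> = 1} = {x \<in> convex hull \<Psi>. x \<bullet> g = 1}"
    unfolding polytope_Int_span using g by blast
  also have "\<dots> = convex hull {\<beta>\<in>\<Psi>. \<beta> \<bullet> g = 1}"
    using g by (intro supporting_slice_eq finite_component) (simp add: hull_inc)
  also have "{\<beta>\<in>\<Psi>. \<beta> \<bullet> g = 1} = top_roots I"
  proof -
    have "\<beta> \<bullet> g = 1 \<longleftrightarrow> (\<forall>\<alpha>\<in>I. coef \<alpha> \<beta> = coef \<alpha> \<theta>)" if "\<beta> \<in> \<Psi>" for \<beta>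
      using g[of \<beta>] that inner_o_vec_le(2)[OF _ that] I by (auto simp: hull_inc)
    then show ?thesis
      unfolding top_roots_def by blast
  qed
  finally show ?thesis .
qed

lemma slice_Int_component:
  assumes "I \<subseteq> \<Delta> \<inter> \<Psi>"
  shows "{x \<in> root_polytope \<Phi> \<inter> span \<Psi>. \<forall>\<alpha>\<in>I. x \<bullet> o_vec \<Phi> \<Delta> \<Psi> \<alpha> = 1} \<inter> \<Psi> = top_roots I"
proof -
  have "\<beta> \<bullet> o_vec \<Phi> \<Delta> \<Psi> \<alpha> = 1 \<longleftrightarrow> coef \<alpha> \<beta> = coef \<alpha> \<theta>" if "\<beta> \<in> \<Psi>" "\<alpha> \<in> I" for \<alpha> \<beta>
    using inner_o_vec_le(2)[of \<alpha> \<beta>] that assms by blast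
  then show ?thesis
    unfolding polytope_Int_span top_roots_def by (auto simp: hull_inc)
qed

context
  fixes f :: 'a and F :: "'a set"
  assumes bounded: "\<And>\<beta>. \<beta> \<in> \<Phi> \<Longrightarrow> \<beta> \<bullet> f \<le> 1"
    and face: "F = {x \<in> root_polytope \<Phi>. x \<bullet> f = 1}"
    and dominant: "\<And>\<alpha>. \<alpha> \<in> \<Delta> \<Longrightarrow> 0 \<le> \<alpha> \<bullet> f"
begin

lemma face_Int_component: "F \<inter> \<Psi> = {\<beta>\<in>\<Psi>. \<beta> \<bullet> f = 1}"
  using component_subset unfolding face root_polytope_def by (auto simp: hull_inc)

lemma face_Int_span: "F \<inter> span \<Psi> = convex hull (F \<inter> \<Psi>)"
proof -
  have "F \<inter> span \<Psi> = {x \<in> convex hull \<Psi>. x \<bullet> f = 1}"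
    unfolding face polytope_Int_span[symmetric] by blast
  also have "\<dots> = convex hull {\<beta>\<in>\<Psi>. \<beta> \<bullet> f = 1}"
    using bounded component_subset by (intro supporting_slice_eq finite_component) blast
  finally show ?thesis
    unfolding face_Int_component .
qed

lemma face_Int_component_top:
  assumes "F \<inter> span \<Psi> \<noteq> {}"
  shows "F \<inter> \<Psi> = top_roots {\<alpha>\<in>\<Delta> \<inter> \<Psi>. \<alpha> \<bullet> f > 0}"
proof -
  have diff: "\<theta> \<bullet> f - \<beta> \<bullet> f = (\<Sum>\<gamma>\<in>\<Delta> \<inter> \<Psi>. (coef \<gamma> \<theta> - coef \<gamma> \<beta>) * (\<gamma> \<bullet> f))" if "\<beta> \<in> \<Psi>" for \<beta>
    unfolding component_inner[OF that] component_inner[OF highest_root_in]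
    by (simp add: sum_subtractf left_diff_distrib)
  have nonneg: "0 \<le> (coef \<gamma> \<theta> - coef \<gamma> \<beta>) * (\<gamma> \<bullet> f)" if "\<beta> \<in> \<Psi>" "\<gamma> \<in> \<Delta> \<inter> \<Psi>" for \<beta> \<gamma>
    using coef_le_highest[OF that] dominant[of \<gamma>] that(2) by simp
  obtain \<beta> where \<beta>: "\<beta> \<in> \<Psi>" "\<beta> \<bullet> f = 1"
  proof -
    have "F \<inter> \<Psi> \<noteq> {}"
      using assms unfolding face_Int_span by (metis convex_hull_empty)
    then show thesis
      using that unfolding face_Int_component by blast
  qed
  have "0 \<le> \<theta> \<bullet> f - \<beta> \<bullet> f"
    unfolding diff[OF \<beta>(1)] using nonneg[OF \<beta>(1)] by (rule sum_nonneg)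
  then have \<theta>: "\<theta> \<bullet> f = 1"
    using \<beta>(2) bounded[of \<theta>] highest_root_in component_subset by force
  have "\<gamma> \<bullet> f = 1 \<longleftrightarrow> (\<forall>\<alpha>\<in>{\<alpha>\<in>\<Delta> \<inter> \<Psi>. \<alpha> \<bullet> f > 0}. coef \<alpha> \<gamma> = coef \<alpha> \<theta>)" if "\<gamma> \<in> \<Psi>" for \<gamma>
  proof -
    have "\<gamma> \<bullet> f = 1 \<longleftrightarrow> (\<Sum>\<alpha>\<in>\<Delta> \<inter> \<Psi>. (coef \<alpha> \<theta> - coef \<alpha> \<gamma>) * (\<alpha> \<bullet> f)) = 0"
      unfolding diff[OF that, symmetric] \<theta> by auto
    also have "\<dots> \<longleftrightarrow> (\<forall>\<alpha>\<in>\<Delta> \<inter> \<Psi>. (coef \<alpha> \<theta> - coef \<alpha> \<gamma>) * (\<alpha> \<bullet> f) = 0)"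
      using finite_base nonneg[OF that] by (intro sum_nonneg_eq_0_iff) auto
    also have "\<dots> \<longleftrightarrow> (\<forall>\<alpha>\<in>{\<alpha>\<in>\<Delta> \<inter> \<Psi>. \<alpha> \<bullet> f > 0}. coef \<alpha> \<gamma> = coef \<alpha> \<theta>)"
      using dominant by (force simp: less_le)
    finally show ?thesis .
  qed
  then show ?thesis
    unfolding face_Int_component top_roots_def by blast
qed

lemma face_simple_roots_correct:
  assumes ne: "F \<inter> span \<Psi> \<noteq> {}"
  defines "J \<equiv> face_simple_roots \<Phi> \<Delta> \<Psi> F"
  shows "J \<subseteq> \<Delta> \<inter> \<Psi>" "J \<noteq> {}" "top_roots J = F \<inter> \<Psi>"
proof -
  obtain K where K: "extremal \<Delta> \<Psi> K" "top_roots K = F \<inter> \<Psi>"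
    using ex_extremal[of "{\<alpha>\<in>\<Delta> \<inter> \<Psi>. \<alpha> \<bullet> f > 0}"] face_Int_component_top[OF ne] by auto
  have K_sub: "K \<subseteq> \<Delta> \<inter> \<Psi>"
    using K(1) extremal_def by blast
  have "J = K"
    unfolding J_def face_simple_roots_def
  proof (rule the_equality)
    show "extremal \<Delta> \<Psi> K \<and> F \<inter> span \<Psi> =
        {x \<in> root_polytope \<Phi> \<inter> span \<Psi>. \<forall>\<alpha>\<in>K. x \<bullet> o_vec \<Phi> \<Delta> \<Psi> \<alpha> = 1}"
      unfolding o_vec_slice[OF K_sub] face_Int_span K(2) using K(1) by simp
  next
    fix L assume L: "extremal \<Delta> \<Psi> L \<and> F \<inter> span \<Psi> =
        {x \<in> root_polytope \<Phi> \<inter> span \<Psi>. \<forall>\<alpha>\<in>L. x \<bullet> o_vec \<Phi> \<Delta> \<Psi> \<alpha> = 1}"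
    then have "L \<subseteq> \<Delta> \<inter> \<Psi>"
      using extremal_def by blast
    then have "top_roots L = F \<inter> span \<Psi> \<inter> \<Psi>"
      using slice_Int_component L by simp
    also have "\<dots> = top_roots K"
      using K(2) span_superset[of \<Psi>] by blast
    finally show "L = K"
      using extremal_unique L K(1) by blast
  qed
  moreover have "K \<noteq> {}"
  proof
    assume "K = {}"
    then have "\<theta> \<in> F" "- \<theta> \<in> F"
      using K(2) highest_root_in uminus_in_component unfolding top_roots_def by auto
    then show False
      unfolding face by simp
  qed
  ultimately show "J \<subseteq> \<Delta> \<inter> \<Psi>" "J \<noteq> {}" "top_roots J = F \<inter> \<Psi>"
    using K_sub K(2) by simp_all
qed

lemma inner_o_face:
  assumes "\<beta> \<in> \<Psi>"
  shows "\<beta> \<bullet> o_face \<Phi> \<Delta> \<Psi> F \<le> 1 \<and> (\<beta> \<bullet> o_face \<Phi> \<Delta> \<Psi> F = 1 \<longleftrightarrow> \<beta> \<in> F)"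
proof (cases "F \<inter> span \<Psi> = {}")
  case True
  then have "\<beta> \<notin> F"
    using assms span_base by blast
  then show ?thesis
    using True by (simp add: o_face_def)
next
  case False
  define J where "J = face_simple_roots \<Phi> \<Delta> \<Psi> F"
  have J: "J \<subseteq> \<Delta> \<inter> \<Psi>" "J \<noteq> {}" "top_roots J = F \<inter> \<Psi>"
    unfolding J_def using face_simple_roots_correct[OF False] by blast+
  have "\<beta> \<bullet> o_vec \<Phi> \<Delta> \<Psi> \<alpha> \<le> 1" "\<beta> \<bullet> o_vec \<Phi> \<Delta> \<Psi> \<alpha> = 1 \<longleftrightarrow> coef \<alpha> \<beta> = coef \<alpha> \<theta>"
    if "\<alpha> \<in> J" for \<alpha>
    using inner_o_vec_le[OF _ assms, of \<alpha>] that J(1) by blast+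
  moreover have "finite J"
    using J(1) finite_base finite_subset by blast
  moreover have "\<beta> \<in> F \<longleftrightarrow> (\<forall>\<alpha>\<in>J. coef \<alpha> \<beta> = coef \<alpha> \<theta>)"
    using J(3) assms unfolding top_roots_def by blast
  ultimately show ?thesis
    using average_le_1[of J "\<lambda>\<alpha>. \<beta> \<bullet> o_vec \<Phi> \<Delta> \<Psi> \<alpha>"] J(2) False
    by (simp add: o_face_def J_def[symmetric] inner_sum_right)
qed

lemma inner_o_face_off:
  assumes "\<beta> \<in> \<Phi>" "\<beta> \<notin> \<Psi>"
  shows "\<beta> \<bullet> o_face \<Phi> \<Delta> \<Psi> F = 0"
proof (cases "F \<inter> span \<Psi> = {}")
  case True
  then show ?thesis
    by (simp add: o_face_def)
next
  case False
  have "\<beta> \<bullet> o_vec \<Phi> \<Delta> \<Psi> \<alpha> = 0" if "\<alpha> \<in> face_simple_roots \<Phi> \<Delta> \<Psi> F" for \<alpha>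
    using inner_o_vec[of \<alpha> \<beta>] coef_off_component[OF assms, of \<alpha>] that
      face_simple_roots_correct(1)[OF False] by auto
  then show ?thesis
    using False by (simp add: o_face_def inner_sum_right)
qed

end

end

section \<open>Standard faces\<close>

context based_root_system
begin

lemma reflection_in_polytope:
  assumes "\<alpha> \<in> \<Phi>" "x \<in> root_polytope \<Phi>"
  shows "reflection \<alpha> x \<in> root_polytope \<Phi>"
  using convex_hull_linear_image[OF linear_reflection, of \<alpha> \<Phi>] reflection_image[OF assms(1)] assms(2)
  unfolding root_polytope_def by auto

lemma proper_face_normal:
  assumes face: "F face_of root_polytope \<Phi>" and "F \<noteq> {}" and proper: "F \<noteq> root_polytope \<Phi>"
  obtains f where "\<And>x. x \<in> root_polytope \<Phi> \<Longrightarrow> x \<bullet> f \<le> 1" "F = {x \<in> root_polytope \<Phi>. x \<bullet> f = 1}"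
proof -
  have "polyhedron (root_polytope \<Phi>)"
    unfolding root_polytope_def using finite_roots
    by (intro polytope_imp_polyhedron) (auto simp: polytope_def)
  then have "F exposed_face_of root_polytope \<Phi>"
    using face exposed_face_of_polyhedron by blast
  then obtain a b where ab: "root_polytope \<Phi> \<subseteq> {x. a \<bullet> x \<le> b}" "F = root_polytope \<Phi> \<inter> {x. a \<bullet> x = b}"
    unfolding exposed_face_of_def by blast
  have le: "a \<bullet> \<beta> \<le> b" "- (a \<bullet> \<beta>) \<le> b" if "\<beta> \<in> \<Phi>" for \<beta>
  proof -
    have "\<beta> \<in> root_polytope \<Phi>" "- \<beta> \<in> root_polytope \<Phi>"
      using that uminus_in_roots unfolding root_polytope_def by (auto intro: hull_inc)
    then have "a \<bullet> \<beta> \<le> b" "a \<bullet> (- \<beta>) \<le> b"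
      using ab(1) by blast+
    then show "a \<bullet> \<beta> \<le> b" "- (a \<bullet> \<beta>) \<le> b"
      by simp_all
  qed
  have "\<Phi> \<noteq> {}"
    using \<open>F \<noteq> {}\<close> ab(2) unfolding root_polytope_def by auto
  then have "b \<ge> 0"
    using le by force
  moreover have "b \<noteq> 0"
  proof
    assume "b = 0"
    then have "\<beta> \<in> {x. a \<bullet> x = 0}" if "\<beta> \<in> \<Phi>" for \<beta>
      using le[OF that] by simp
    then have "root_polytope \<Phi> \<subseteq> {x. a \<bullet> x = 0}"
      unfolding root_polytope_def by (intro hull_minimal convex_hyperplane) blast
    then show False
      using ab(2) \<open>b = 0\<close> proper by blast
  qed
  ultimately have b: "b > 0"
    by simp
  have x: "x \<bullet> ((1 / b) *\<^sub>R a) = (a \<bullet> x) / b" for x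
    by (simp add: inner_commute)
  show thesis
  proof (rule that[of "(1 / b) *\<^sub>R a"])
    show "x \<bullet> ((1 / b) *\<^sub>R a) \<le> 1" if "x \<in> root_polytope \<Phi>" for x
      unfolding x using ab(1) b that by (auto simp: divide_le_eq)
    show "F = {x \<in> root_polytope \<Phi>. x \<bullet> ((1 / b) *\<^sub>R a) = 1}"
      unfolding x ab(2) using b by auto
  qed
qed

text \<open>
  Among the normals that leave a fixed gap below the roots off \<open>F\<close>, the shortest one is
  fixed by every simple reflection fixing the dominant point \<open>x\<close> of the relative interior;
  the remaining simple roots pair nonnegatively with any normal of \<open>F\<close>.
\<close>

lemma standard_face_dominant_normal:
  assumes std: "standard_face \<Phi> \<Delta> F" and "F \<noteq> {}"
  obtains f where "\<And>\<beta>. \<beta> \<in> \<Phi> \<Longrightarrow> \<beta> \<bullet> f \<le> 1" "F = {x \<in> root_polytope \<Phi>. x \<bullet> f = 1}"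
    "\<And>\<alpha>. \<alpha> \<in> \<Delta> \<Longrightarrow> 0 \<le> \<alpha> \<bullet> f"
proof -
  have face: "F face_of root_polytope \<Phi>" and proper: "F \<noteq> root_polytope \<Phi>"
    using assms unfolding standard_face_def by auto
  obtain x where x: "x \<in> rel_interior F" "x \<in> fundamental_chamber \<Phi> \<Delta>"
    using assms unfolding standard_face_def by blast
  have xF: "x \<in> F"
    using x(1) rel_interior_subset by blast
  obtain f0 where f0: "\<And>x. x \<in> root_polytope \<Phi> \<Longrightarrow> x \<bullet> f0 \<le> 1" "F = {x \<in> root_polytope \<Phi>. x \<bullet> f0 = 1}"
    using proper_face_normal[OF face \<open>F \<noteq> {}\<close> proper] by blast
  have root_in: "\<beta> \<in> root_polytope \<Phi>" if "\<beta> \<in> \<Phi>" for \<beta>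
    using that unfolding root_polytope_def by (rule hull_inc)
  define gaps where "gaps = insert 1 ((\<lambda>\<beta>. 1 - \<beta> \<bullet> f0) ` (\<Phi> - F))"
  have fin: "finite gaps"
    using finite_roots gaps_def by simp
  have pos: "g > 0" if "g \<in> gaps" for g
    using that f0 root_in unfolding gaps_def by (force simp: less_le)
  define \<epsilon> where "\<epsilon> = Min gaps"
  have \<epsilon>: "\<epsilon> > 0" "\<And>\<beta>. \<beta> \<in> \<Phi> - F \<Longrightarrow> \<epsilon> \<le> 1 - \<beta> \<bullet> f0"
    using pos fin Min_in[OF fin] Min_le[OF fin] unfolding \<epsilon>_def gaps_def by auto
  define N where "N = (\<Inter>\<beta>\<in>\<Phi> \<inter> F. {f. \<beta> \<bullet> f = 1}) \<inter> (\<Inter>\<beta>\<in>\<Phi> - F. {f. \<beta> \<bullet> f \<le> 1 - \<epsilon>})"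
  have f0N: "f0 \<in> N"
    using \<epsilon>(2) f0(2) unfolding N_def by force
  have "closed N"
    unfolding N_def by (intro closed_Int closed_INT ballI closed_hyperplane closed_halfspace_le)
  have "convex N"
    unfolding N_def by (intro convex_Int convex_INT convex_hyperplane convex_halfspace_le)
  define f where "f = closest_point N 0"
  have fN: "f \<in> N"
    unfolding f_def using closest_point_in_set[OF \<open>closed N\<close>] f0N by blast
  have f_root: "\<beta> \<bullet> f \<le> 1 \<and> (\<beta> \<bullet> f = 1 \<longleftrightarrow> \<beta> \<in> F)" if "\<beta> \<in> \<Phi>" for \<beta>
  proof (cases "\<beta> \<in> F")
    case True
    then show ?thesis
      using fN that unfolding N_def by simp
  next
    case False
    then have "\<beta> \<bullet> f \<le> 1 - \<epsilon>"
      using fN that unfolding N_def by blast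
    then show ?thesis
      using \<epsilon>(1) False by simp
  qed
  have f_face: "F = {x \<in> root_polytope \<Phi>. x \<bullet> f = 1}"
  proof -
    have "F = convex hull {\<beta>\<in>\<Phi>. \<beta> \<bullet> f0 = 1}"
      unfolding f0(2) root_polytope_def
      using f0(1) root_in by (intro supporting_slice_eq finite_roots) blast
    also have "{\<beta>\<in>\<Phi>. \<beta> \<bullet> f0 = 1} = {\<beta>\<in>\<Phi>. \<beta> \<bullet> f = 1}"
      using f_root f0(2) root_in by blast
    also have "convex hull {\<beta>\<in>\<Phi>. \<beta> \<bullet> f = 1} = {x \<in> root_polytope \<Phi>. x \<bullet> f = 1}"
      unfolding root_polytope_def
      using f_root by (intro supporting_slice_eq[symmetric] finite_roots) blast
    finally show ?thesis .
  qed
  have f_le: "y \<bullet> f \<le> 1" if "y \<in> root_polytope \<Phi>" for y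
    using supporting_hull_le[of \<Phi> f] f_root that unfolding root_polytope_def by blast
  have "0 \<le> \<alpha> \<bullet> f" if \<alpha>: "\<alpha> \<in> \<Delta>" for \<alpha>
  proof (cases "x \<bullet> \<alpha> = 0")
    case True
    have \<alpha>\<Phi>: "\<alpha> \<in> \<Phi>"
      using \<alpha> base_subset by blast
    define T where "T = root_polytope \<Phi> \<inter> {y. reflection \<alpha> f0 \<bullet> y = 1}"
    have swap: "reflection \<alpha> f0 \<bullet> y = reflection \<alpha> y \<bullet> f0" for y
      by (subst inner_reflection) (rule inner_commute)
    have "T face_of root_polytope \<Phi>"
      unfolding T_def
    proof (rule face_of_Int_supporting_hyperplane_le)
      show "convex (root_polytope \<Phi>)"
        by (simp add: root_polytope_def)
      show "reflection \<alpha> f0 \<bullet> y \<le> 1" if "y \<in> root_polytope \<Phi>" for y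
        unfolding swap using f0(1) reflection_in_polytope[OF \<alpha>\<Phi> that] .
    qed
    moreover have "F \<subseteq> root_polytope \<Phi>"
      using f0(2) by blast
    moreover have "x \<in> T"
      using xF reflection_orthogonal[OF True] unfolding T_def swap f0(2) by simp
    ultimately have "F \<subseteq> T"
      using subset_of_face_of x(1) by blast
    then have "reflection \<alpha> y \<in> F" if "y \<in> F" for y
      using that reflection_in_polytope[OF \<alpha>\<Phi>] unfolding T_def swap f0(2) by blast
    then have inv: "reflection \<alpha> y \<in> F \<longleftrightarrow> y \<in> F" for y
      by (metis reflection_reflection)
    have "reflection \<alpha> f \<in> N"
    proof -
      have "\<beta> \<bullet> reflection \<alpha> f = 1" if "\<beta> \<in> \<Phi> \<inter> F" for \<beta>
        using fN reflection_in_roots[OF \<alpha>\<Phi>, of \<beta>] inv that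
        unfolding N_def inner_reflection[symmetric] by blast
      moreover have "\<beta> \<bullet> reflection \<alpha> f \<le> 1 - \<epsilon>" if "\<beta> \<in> \<Phi> - F" for \<beta>
        using fN reflection_in_roots[OF \<alpha>\<Phi>, of \<beta>] inv that
        unfolding N_def inner_reflection[symmetric] by blast
      ultimately show ?thesis
        unfolding N_def by blast
    qed
    moreover have "\<forall>z\<in>N. dist 0 (reflection \<alpha> f) \<le> dist 0 z"
      using closest_point_le[OF \<open>closed N\<close>, of _ 0] unfolding f_def by simp
    ultimately have "reflection \<alpha> f = f"
      using closest_point_unique[OF \<open>convex N\<close> \<open>closed N\<close>] unfolding f_def by blast
    then show ?thesis
      using base_nonzero[OF \<alpha>] by (simp add: reflection_eq_self_iff inner_commute)
  next
    case False
    then have pos: "x \<bullet> \<alpha> > 0"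
      using x(2) \<alpha> unfolding fundamental_chamber_def by force
    have "reflection \<alpha> x \<in> root_polytope \<Phi>"
      using reflection_in_polytope[of \<alpha> x] \<alpha> base_subset xF f0(2) by blast
    then have "reflection \<alpha> x \<bullet> f \<le> x \<bullet> f"
      using f_le xF f_face by simp
    then have "0 \<le> 2 * (x \<bullet> \<alpha>) / (\<alpha> \<bullet> \<alpha>) * (\<alpha> \<bullet> f)"
      by (simp add: reflection_def inner_diff_left)
    moreover have "2 * (x \<bullet> \<alpha>) / (\<alpha> \<bullet> \<alpha>) > 0"
      using pos base_inner_pos[OF \<alpha>] by simp
    ultimately show ?thesis
      by (metis zero_le_mult_iff not_less)
  qed
  then show thesis
    using that[of f] f_root f_face by blast
qed

lemma ex_component:
  assumes "\<beta> \<in> \<Phi>"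
  obtains \<Psi> where "\<Psi> \<in> irreducible_components \<Phi>" "\<beta> \<in> \<Psi>"
proof -
  define closed_under where "closed_under C \<longleftrightarrow> C \<subseteq> \<Phi> \<and> \<beta> \<in> C \<and> (\<forall>a\<in>C. \<forall>b\<in>\<Phi> - C. a \<bullet> b = 0)" for C
  have "closed_under \<Phi>"
    unfolding closed_under_def using assms by blast
  then obtain C where C: "closed_under C" and least: "\<And>D. closed_under D \<Longrightarrow> card C \<le> card D"
    using ex_has_least_nat[of closed_under \<Phi> card] by blast
  have fin: "finite C"
    using C finite_roots finite_subset unfolding closed_under_def by blast
  have split: False if AB: "A \<union> B = C" "A \<inter> B = {}" "B \<noteq> {}" "\<forall>a\<in>A. \<forall>b\<in>B. a \<bullet> b = 0" "\<beta> \<in> A" for A B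
  proof -
    have "a \<bullet> b = 0" if "a \<in> A" "b \<in> \<Phi> - A" for a b
    proof (cases "b \<in> B")
      case True
      then show ?thesis
        using AB(4) that(1) by blast
    next
      case False
      then show ?thesis
        using C that AB(1) unfolding closed_under_def by blast
    qed
    then have "closed_under A"
      using C AB(1,5) unfolding closed_under_def by blast
    moreover have "A \<subset> C"
      using AB(1-3) by blast
    ultimately show False
      using least[of A] psubset_card_mono[OF fin, of A] by simp
  qed
  have "irreducible_roots C"
    unfolding irreducible_roots_def
  proof (intro conjI notI)
    show "C = {} \<Longrightarrow> False"
      using C closed_under_def by blast
    assume "\<exists>A B. A \<noteq> {} \<and> B \<noteq> {} \<and> A \<union> B = C \<and> A \<inter> B = {} \<and> (\<forall>a\<in>A. \<forall>b\<in>B. a \<bullet> b = 0)"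
    then obtain A B where AB: "A \<noteq> {}" "B \<noteq> {}" "A \<union> B = C" "A \<inter> B = {}" "\<forall>a\<in>A. \<forall>b\<in>B. a \<bullet> b = 0"
      by blast
    have "\<beta> \<in> A \<or> \<beta> \<in> B"
      using C AB(3) unfolding closed_under_def by blast
    then show False
    proof
      assume "\<beta> \<in> A"
      then show False
        using split[OF AB(3,4,2,5)] by blast
    next
      assume "\<beta> \<in> B"
      moreover have "B \<union> A = C" "B \<inter> A = {}" "\<forall>b\<in>B. \<forall>a\<in>A. b \<bullet> a = 0"
        using AB(3-5) by (blast, blast, metis inner_commute)
      ultimately show False
        using split[of B A] AB(1) by blast
    qed
  qed
  then show thesis
    using that[of C] C unfolding irreducible_components_def closed_under_def by blast
qed

lemma component_unique:
  assumes "\<Psi> \<in> irreducible_components \<Phi>" "\<Psi>' \<in> irreducible_components \<Phi>" "\<beta> \<in> \<Psi>" "\<beta> \<in> \<Psi>'"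
  shows "\<Psi> = \<Psi>'"
proof -
  have sub: "A \<subseteq> B" if AB: "A \<in> irreducible_components \<Phi>" "B \<in> irreducible_components \<Phi>" "\<beta> \<in> A" "\<beta> \<in> B" for A B
  proof (rule ccontr)
    assume "\<not> A \<subseteq> B"
    then have "A - B \<noteq> {}" "A \<inter> B \<noteq> {}" "(A \<inter> B) \<union> (A - B) = A" "(A \<inter> B) \<inter> (A - B) = {}"
      using AB(3,4) by blast+
    moreover have "\<forall>a\<in>A \<inter> B. \<forall>b\<in>A - B. a \<bullet> b = 0"
      using AB(1,2) unfolding irreducible_components_def by blast
    ultimately have "\<exists>S T. S \<noteq> {} \<and> T \<noteq> {} \<and> S \<union> T = A \<and> S \<inter> T = {} \<and> (\<forall>a\<in>S. \<forall>b\<in>T. a \<bullet> b = 0)"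
      by (intro exI[of _ "A \<inter> B"] exI[of _ "A - B"] conjI)
    moreover have "irreducible_roots A"
      using AB(1) irreducible_components_def by blast
    ultimately show False
      unfolding irreducible_roots_def by (elim conjE notE)
  qed
  show ?thesis
    using sub[of \<Psi> \<Psi>'] sub[of \<Psi>' \<Psi>] assms by blast
qed

lemma inner_sum_o_face:
  assumes f: "\<And>\<beta>. \<beta> \<in> \<Phi> \<Longrightarrow> \<beta> \<bullet> f \<le> 1" "F = {x \<in> root_polytope \<Phi>. x \<bullet> f = 1}"
    "\<And>\<alpha>. \<alpha> \<in> \<Delta> \<Longrightarrow> 0 \<le> \<alpha> \<bullet> f"
    and \<beta>: "\<beta> \<in> \<Phi>"
  defines "g \<equiv> \<Sum>\<Psi>\<in>irreducible_components \<Phi>. o_face \<Phi> \<Delta> \<Psi> F"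
  shows "\<beta> \<bullet> g \<le> 1 \<and> (\<beta> \<bullet> g = 1 \<longleftrightarrow> \<beta> \<in> F)"
proof -
  obtain \<Psi> where \<Psi>: "\<Psi> \<in> irreducible_components \<Phi>" "\<beta> \<in> \<Psi>"
    using ex_component[OF \<beta>] .
  have comp: "root_component \<Phi> \<Delta> \<Psi>'" if "\<Psi>' \<in> irreducible_components \<Phi>" for \<Psi>'
    by unfold_locales (fact that)
  have fin: "finite (irreducible_components \<Phi>)"
    by (rule finite_subset[of _ "Pow \<Phi>"]) (auto simp: irreducible_components_def finite_roots)
  have "\<beta> \<bullet> g = (\<Sum>\<Psi>'\<in>irreducible_components \<Phi>. \<beta> \<bullet> o_face \<Phi> \<Delta> \<Psi>' F)"
    by (simp add: g_def inner_sum_right)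
  also have "\<dots> = (\<Sum>\<Psi>'\<in>{\<Psi>}. \<beta> \<bullet> o_face \<Phi> \<Delta> \<Psi>' F)"
  proof (rule sum.mono_neutral_right[OF fin])
    show "\<forall>\<Psi>'\<in>irreducible_components \<Phi> - {\<Psi>}. \<beta> \<bullet> o_face \<Phi> \<Delta> \<Psi>' F = 0"
    proof
      fix \<Psi>' assume \<Psi>': "\<Psi>' \<in> irreducible_components \<Phi> - {\<Psi>}"
      then have "\<beta> \<notin> \<Psi>'"
        using component_unique \<Psi> by blast
      then show "\<beta> \<bullet> o_face \<Phi> \<Delta> \<Psi>' F = 0"
        using root_component.inner_o_face_off[OF comp f \<beta>] \<Psi>' by blast
    qed
  qed (use \<Psi>(1) in simp)
  finally have "\<beta> \<bullet> g = \<beta> \<bullet> o_face \<Phi> \<Delta> \<Psi> F"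
    by simp
  then show ?thesis
    using root_component.inner_o_face[OF comp[OF \<Psi>(1)] f \<Psi>(2)] by simp
qed

end

theorem proposition3p11:
  fixes \<Phi> \<Delta> F :: "'a::euclidean_space set"
  assumes "root_system \<Phi>"
    and "simple_roots \<Phi> \<Delta>"
    and "standard_face \<Phi> \<Delta> F"
  shows "(\<forall>x\<in>root_polytope \<Phi>.
            x \<bullet> (\<Sum>\<Psi>\<in>irreducible_components \<Phi>. o_face \<Phi> \<Delta> \<Psi> F) \<le> 1) \<and>
         F = {x \<in> root_polytope \<Phi>.
            x \<bullet> (\<Sum>\<Psi>\<in>irreducible_components \<Phi>. o_face \<Phi> \<Delta> \<Psi> F) = 1}"
proof (cases "F = {}")
  case True
  then show ?thesis
    by (simp add: o_face_def)
next
  case False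
  interpret based_root_system \<Phi> \<Delta>
    using assms(1,2) by unfold_locales
  define g where "g = (\<Sum>\<Psi>\<in>irreducible_components \<Phi>. o_face \<Phi> \<Delta> \<Psi> F)"
  obtain f where f: "\<And>\<beta>. \<beta> \<in> \<Phi> \<Longrightarrow> \<beta> \<bullet> f \<le> 1" "F = {x \<in> root_polytope \<Phi>. x \<bullet> f = 1}"
    "\<And>\<alpha>. \<alpha> \<in> \<Delta> \<Longrightarrow> 0 \<le> \<alpha> \<bullet> f"
    using standard_face_dominant_normal[OF assms(3) False] by metis
  have g: "\<beta> \<bullet> g \<le> 1 \<and> (\<beta> \<bullet> g = 1 \<longleftrightarrow> \<beta> \<in> F)" if "\<beta> \<in> \<Phi>" for \<beta>
    unfolding g_def using inner_sum_o_face[OF f that] .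
  have "F = convex hull {\<beta>\<in>\<Phi>. \<beta> \<bullet> f = 1}"
    unfolding f(2) root_polytope_def using f(1) by (rule supporting_slice_eq[OF finite_roots])
  also have "{\<beta>\<in>\<Phi>. \<beta> \<bullet> f = 1} = {\<beta>\<in>\<Phi>. \<beta> \<bullet> g = 1}"
    using g hull_inc[of _ \<Phi> convex] unfolding f(2) root_polytope_def by blast
  also have "convex hull {\<beta>\<in>\<Phi>. \<beta> \<bullet> g = 1} = {x \<in> root_polytope \<Phi>. x \<bullet> g = 1}"
    unfolding root_polytope_def using g by (intro supporting_slice_eq[symmetric] finite_roots) blast
  finally have "F = {x \<in> root_polytope \<Phi>. x \<bullet> g = 1}" .
  moreover have "\<forall>x\<in>root_polytope \<Phi>. x \<bullet> g \<le> 1"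
    using supporting_hull_le[of \<Phi> g] g unfolding root_polytope_def by blast
  ultimately show ?thesis
    unfolding g_def by blast
qed

end
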